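(* Let $\Lambda$ be a countable subgroup of $((0,+\infty),\cdot)$, let $\Gamma\subset\mathbb{R}$ be a $\mathbb{Z}\cdot\Lambda$-submodule, and let $\ell\in\Gamma$ with $\ell>1$. Consider the action $\beta:\Gamma\ltimes\Lambda\curvearrowright\mathbb{R}_\Gamma$ given by $(c,\mu)(a_\pm)=(\mu(a+c))_\pm$ for $a\in\Gamma$ and $(c,\mu)(t)=\mu(t+c)$ for $t\in\mathbb{R}\setminus\Gamma$, and its restriction to a partial action on $[0_+,\ell_-]$. Then $$\mathsf{F}(\Gamma\ltimes\Lambda\ltimes[0_+,\ell_-])\cong V(\Gamma,\Lambda,\ell).$$
   Context: $\mathbb{Z}\cdot\Lambda$ is the subring of $\mathbb{R}$ generated by $\Lambda$; a $\mathbb{Z}\cdot\Lambda$-submodule of $\mathbb{R}$ is an additive subgroup $\Gamma$ with $\Lambda\cdot\Gamma=\Gamma$. $V(\Gamma,\Lambda,\ell)$ is the group, under composition, of right-continuous bijections $f:[0,\ell]\to[0,\ell]$ for which there are points $0=x_0<x_1<\dots<x_n=\ell$ in $\Gamma$ such that on each $[x_i,x_{i+1})$ the map $f$ is affine with slope in $\Lambda$. $\Gamma\ltimes\Lambda$ is the set $\Gamma\times\Lambda$ with product $(a,\mu)(b,\lambda)=(\lambda^{-1}a+b,\mu\lambda)$. $\mathbb{R}_\Gamma=(\mathbb{R}\setminus\Gamma)\sqcup\{a_+,a_-: a\in\Gamma\}$, with $q:\mathbb{R}_\Gamma\to\mathbb{R}$, $q(t)=t$, $q(a_\pm)=a$,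 is totally ordered by: $q(x)<q(y)\Rightarrow x<y$, and $a_-<a_+$ for $a\in\Gamma$; it carries the order topology. $[0_+,\ell_-]=\{x\in\mathbb{R}_\Gamma:0_+\le x\le\ell_-\}$. $\Gamma\ltimes\Lambda\ltimes[0_+,\ell_-]$ is the groupoid of pairs $(g,x)$ with $g\in\Gamma\ltimes\Lambda$ and $x,gx\in[0_+,\ell_-]$, source $x$, range $gx$, product $(g,hx)(h,x)=(gh,x)$, with the topology inherited from (discrete group) $\times\,\mathbb{R}_\Gamma$. For an étale groupoid $\mathcal{G}$ with compact unit space, the topological full group $\mathsf{F}(\mathcal{G})$ is the group, under set multiplication, of compact open bisections $B\subset\mathcal{G}$ with $s(B)=r(B)=\mathcal{G}^{(0)}$; a bisection is an open set on which $s$ and $r$ are homeomorphisms onto open subsets of $\mathcal{G}^{(0)}$. *)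

theory Defs
  imports "HOL-Analysis.Analysis" "HOL-Algebra.Bij"
begin

section \<open>The data \<open>\<Lambda>\<close> and \<open>\<Gamma>\<close>\<close>

definition pos_real_group :: "real monoid" where
  "pos_real_group = \<lparr>carrier = {0<..}, mult = (*), one = 1\<rparr>"

definition real_add_group :: "real monoid" where
  "real_add_group = \<lparr>carrier = UNIV, mult = (+), one = 0\<rparr>"

text \<open>For an additive subgroup \<open>\<Gamma>\<close>, the condition \<open>\<Lambda> \<cdot> \<Gamma> = \<Gamma>\<close> says that \<open>\<Gamma>\<close> is a submodule
  over the subring of the reals generated by \<open>\<Lambda>\<close>.\<close>

definition ZLambda_submodule :: "real set \<Rightarrow> real set \<Rightarrow> bool" where
  "ZLambda_submodule \<Lambda> \<Gamma> \<longleftrightarrow>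
     subgroup \<Gamma> real_add_group \<and> {\<mu> * a |\<mu> a. \<mu> \<in> \<Lambda> \<and> a \<in> \<Gamma>} = \<Gamma>"


section \<open>The group \<open>V(\<Gamma>,\<Lambda>,\<ell>)\<close>\<close>

definition right_continuous_on :: "real set \<Rightarrow> (real \<Rightarrow> real) \<Rightarrow> bool" where
  "right_continuous_on S f \<longleftrightarrow> (\<forall>x\<in>S. continuous (at x within (S \<inter> {x..})) f)"

definition piecewise_affine :: "real set \<Rightarrow> real set \<Rightarrow> real \<Rightarrow> (real \<Rightarrow> real) \<Rightarrow> bool" where
  "piecewise_affine \<Gamma> \<Lambda> l f \<longleftrightarrow>
     (\<exists>(n::nat) (x :: nat \<Rightarrow> real).
        x 0 = 0 \<and> x n = l \<and> (\<forall>i<n. x i < x (Suc i)) \<and> (\<forall>i\<le>n. x i \<in> \<Gamma>) \<and>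
        (\<forall>i<n. \<exists>\<mu>\<in>\<Lambda>. \<exists>d. \<forall>t\<in>{x i..<x (Suc i)}. f t = \<mu> * t + d))"

definition V_group :: "real set \<Rightarrow> real set \<Rightarrow> real \<Rightarrow> (real \<Rightarrow> real) monoid" where
  "V_group \<Gamma> \<Lambda> l =
     (BijGroup {0..l})
       \<lparr>carrier := {f \<in> Bij {0..l}. right_continuous_on {0..l} f \<and> piecewise_affine \<Gamma> \<Lambda> l f}\<rparr>"


section \<open>The group \<open>\<Gamma> \<ltimes> \<Lambda>\<close>\<close>

definition GL_group :: "real set \<Rightarrow> real set \<Rightarrow> (real \<times> real) monoid" where
  "GL_group \<Gamma> \<Lambda> =
     \<lparr>carrier = \<Gamma> \<times> \<Lambda>,
      mult = (\<lambda>(a, \<mu>) (b, \<nu>). (inverse \<nu> * a + b, \<mu> * \<nu>)),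
      one = (0, 1)\<rparr>"


section \<open>The space \<open>\<real>\<^sub>\<Gamma>\<close>\<close>

text \<open>\<open>Reg t\<close>, \<open>Minus a\<close>, \<open>Plus a\<close> stand for \<open>t\<close>, \<open>a\<^sub>-\<close>, \<open>a\<^sub>+\<close>. The type contains these for all
  reals; the space for a given \<open>\<Gamma>\<close> is the carrier set \<open>RG \<Gamma>\<close>.\<close>

datatype split_real = Reg real | Minus real | Plus real

fun qmap :: "split_real \<Rightarrow> real" where
  "qmap (Reg t) = t"
| "qmap (Minus a) = a"
| "qmap (Plus a) = a"

definition RG :: "real set \<Rightarrow> split_real set" where
  "RG \<Gamma> = Reg ` (- \<Gamma>) \<union> Plus ` \<Gamma> \<union> Minus ` \<Gamma>"

definition RG_less :: "real set \<Rightarrow> split_real \<Rightarrow> split_real \<Rightarrow> bool" where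
  "RG_less \<Gamma> x y \<longleftrightarrow>
     x \<in> RG \<Gamma> \<and> y \<in> RG \<Gamma> \<and> (qmap x < qmap y \<or> (\<exists>a\<in>\<Gamma>. x = Minus a \<and> y = Plus a))"

definition RG_le :: "real set \<Rightarrow> split_real \<Rightarrow> split_real \<Rightarrow> bool" where
  "RG_le \<Gamma> x y \<longleftrightarrow> x \<in> RG \<Gamma> \<and> y \<in> RG \<Gamma> \<and> (x = y \<or> RG_less \<Gamma> x y)"

text \<open>The order topology of a set \<open>A\<close> with strict order \<open>lt\<close>, generated by the open rays with
  endpoint in \<open>A\<close>.\<close>

definition order_topology_on :: "'a set \<Rightarrow> ('a \<Rightarrow> 'a \<Rightarrow> bool) \<Rightarrow> 'a topology" where
  "order_topology_on A lt =
     topology_generated_by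
       ({A} \<union> (\<lambda>a. {x \<in> A. lt a x}) ` A \<union> (\<lambda>a. {x \<in> A. lt x a}) ` A)"

definition RG_top :: "real set \<Rightarrow> split_real topology" where
  "RG_top \<Gamma> = order_topology_on (RG \<Gamma>) (RG_less \<Gamma>)"

definition RG_interval :: "real set \<Rightarrow> split_real \<Rightarrow> split_real \<Rightarrow> split_real set" where
  "RG_interval \<Gamma> x y = {z \<in> RG \<Gamma>. RG_le \<Gamma> x z \<and> RG_le \<Gamma> z y}"

fun beta :: "real \<times> real \<Rightarrow> split_real \<Rightarrow> split_real" where
  "beta (c, \<mu>) (Reg t) = Reg (\<mu> * (t + c))"
| "beta (c, \<mu>) (Minus a) = Minus (\<mu> * (a + c))"
| "beta (c, \<mu>) (Plus a) = Plus (\<mu> * (a + c))"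


section \<open>Topological groupoids and the topological full group\<close>

text \<open>The unit space is a separate type \<open>'u\<close>, embedded in the arrows by \<open>gunit\<close>. The product
  \<open>gmult g h\<close> is meaningful only when \<open>src g = rng h\<close>.\<close>

record ('a, 'u) top_groupoid =
  arrow_top :: "'a topology"
  unit_top :: "'u topology"
  src :: "'a \<Rightarrow> 'u"
  rng :: "'a \<Rightarrow> 'u"
  gmult :: "'a \<Rightarrow> 'a \<Rightarrow> 'a"
  gunit :: "'u \<Rightarrow> 'a"

definition bisection :: "('a, 'u) top_groupoid \<Rightarrow> 'a set \<Rightarrow> bool" where
  "bisection \<G> B \<longleftrightarrow>
     openin (arrow_top \<G>) B \<and>
     (\<forall>p \<in> {src \<G>, rng \<G>}.
        openin (unit_top \<G>) (p ` B) \<and>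
        homeomorphic_map (subtopology (arrow_top \<G>) B) (subtopology (unit_top \<G>) (p ` B)) p)"

definition full_group :: "('a, 'u) top_groupoid \<Rightarrow> 'a set monoid" where
  "full_group \<G> =
     \<lparr>carrier = {B. bisection \<G> B \<and> compactin (arrow_top \<G>) B \<and>
                    src \<G> ` B = topspace (unit_top \<G>) \<and> rng \<G> ` B = topspace (unit_top \<G>)},
      mult = (\<lambda>B C. {gmult \<G> b c |b c. b \<in> B \<and> c \<in> C \<and> src \<G> b = rng \<G> c}),
      one = gunit \<G> ` topspace (unit_top \<G>)\<rparr>"

text \<open>The groupoid of the partial action on \<open>A\<close> obtained by restricting the action \<open>act\<close> of the
  discrete group \<open>G\<close> on the space \<open>X\<close>.\<close>

definition restricted_transformation_groupoid ::
  "'g monoid \<Rightarrow> ('g \<Rightarrow> 'x \<Rightarrow> 'x) \<Rightarrow> 'x topology \<Rightarrow> 'x set \<Rightarrow> ('g \<times> 'x, 'x) top_groupoid" where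
  "restricted_transformation_groupoid G act X A =
     \<lparr>arrow_top = subtopology (prod_topology (discrete_topology (carrier G)) X)
                    {(g, x). g \<in> carrier G \<and> x \<in> A \<and> act g x \<in> A},
      unit_top = subtopology X A,
      src = snd,
      rng = (\<lambda>(g, x). act g x),
      gmult = (\<lambda>(g, y) (h, x). (g \<otimes>\<^bsub>G\<^esub> h, x)),
      gunit = (\<lambda>x. (\<one>\<^bsub>G\<^esub>, x))\<rparr>"

definition GL_groupoid ::
  "real set \<Rightarrow> real set \<Rightarrow> real \<Rightarrow> ((real \<times> real) \<times> split_real, split_real) top_groupoid" where
  "GL_groupoid \<Gamma> \<Lambda> l =
     restricted_transformation_groupoid (GL_group \<Gamma> \<Lambda>) beta (RG_top \<Gamma>)
       (RG_interval \<Gamma> (Plus 0) (Minus l))"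

end

theory Submission
  imports Defs
begin

section \<open>Germs on the split line\<close>

text \<open>The isomorphism sends \<open>f \<in> V(\<Gamma>,\<Lambda>,\<ell>)\<close> to the set of pairs \<open>(g, x)\<close> such that \<open>f\<close> has germ \<open>g\<close> at \<open>x\<close>, where the
  germ at \<open>a\<^sub>+\<close> is taken from the right, at \<open>a\<^sub>-\<close> from the left, and at \<open>t \<notin> \<Gamma>\<close> from both sides. Affine germs
  are unique, so these sets multiply like the maps. The core is that \<open>V(\<Gamma>,\<Lambda>,\<ell>)\<close> consists exactly of the
  bijections of \<open>[0,\<ell>]\<close> with a germ in \<open>\<Gamma> \<ltimes> \<Lambda>\<close> at every point of \<open>[0\<^sub>+,\<ell>\<^sub>-]\<close>: since the images of the affine
  pieces tile \<open>[0,\<ell>)\<close>, their end points and hence the translation parts lie in \<open>\<Gamma>\<close>; and a bisection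
  argument on \<open>[0,\<ell>]\<close> turns the germs into a finite partition. Every compact open bisection with full source and
  range is the graph of a locally constant label in \<open>\<Gamma> \<ltimes> \<Lambda>\<close>, and acting with the label on the points \<open>a\<^sub>+\<close> and
  \<open>t \<notin> \<Gamma>\<close> recovers \<open>f\<close>.\<close>

fun aff :: "real \<times> real \<Rightarrow> real \<Rightarrow> real" where
  "aff (c, \<mu>) t = \<mu> * (t + c)"

text \<open>The split point \<open>a\<^sub>-\<close> sees only the points strictly left of \<open>a\<close>, because a right-continuous
  function may jump at \<open>a\<close>; \<open>a\<^sub>+\<close> sees \<open>a\<close> itself.\<close>

fun side :: "split_real \<Rightarrow> real \<Rightarrow> real set" where
  "side (Reg t) e = {t - e<..<t + e}"
| "side (Plus a) e = {a..<a + e}"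
| "side (Minus a) e = {a - e<..<a}"

text \<open>A neighbourhood base of the order topology. Comparing sides, rather than naming order
  intervals, lets an affine formula valid on \<open>side x e\<close> pass to every member of the
  set, and makes each such set open by transitivity of inclusion.\<close>

definition nbr :: "real set \<Rightarrow> split_real \<Rightarrow> real \<Rightarrow> split_real set" where
  "nbr \<Gamma> x e = {y \<in> RG \<Gamma>. \<exists>d>0. side y d \<subseteq> side x e}"

text \<open>Right continuity attaches the value at \<open>t\<close> to the right side of
  \<open>t\<close>, so a point of \<Gamma> is represented by its upper split point. Real points and
  split points other than the \<open>Minus a\<close> correspond under this map.\<close>

definition rlift :: "real set \<Rightarrow> real \<Rightarrow> split_real" where
  "rlift \<Gamma> t = (if t \<in> \<Gamma> then Plus t else Reg t)"

definition has_germ :: "(real \<Rightarrow> real) \<Rightarrow> split_real \<Rightarrow> real \<times> real \<Rightarrow> bool" where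
  "has_germ f x g \<longleftrightarrow> (\<exists>e>0. \<forall>s\<in>side x e. f s = aff g s)"

text \<open>The inverse in \<open>GL_group\<close>: solving \<mu> * (t + c) = s gives t = inverse
  \<mu> * (s - \<mu> * c).\<close>

definition ginv :: "real \<times> real \<Rightarrow> real \<times> real" where
  "ginv g = (- (snd g * fst g), inverse (snd g))"

section \<open>Neighbourhoods of split points\<close>

lemma rlift_in_RG: "rlift \<Gamma> t \<in> RG \<Gamma>"
  by (auto simp: rlift_def RG_def)

lemma qmap_rlift [simp]: "qmap (rlift \<Gamma> t) = t"
  by (simp add: rlift_def)

lemma RG_cases:
  assumes "x \<in> RG \<Gamma>"
  obtains (Reg) t where "x = Reg t" "t \<notin> \<Gamma>" | (Plus) a where "x = Plus a" "a \<in> \<Gamma>"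
    | (Minus) a where "x = Minus a" "a \<in> \<Gamma>"
  using assms by (auto simp: RG_def)

lemma side_mono: "d \<le> e \<Longrightarrow> side x d \<subseteq> side x e"
  by (cases x) auto

lemma nbr_mono: "d \<le> e \<Longrightarrow> nbr \<Gamma> x d \<subseteq> nbr \<Gamma> x e"
  unfolding nbr_def using side_mono by blast

lemma nbr_self: "x \<in> RG \<Gamma> \<Longrightarrow> 0 < e \<Longrightarrow> x \<in> nbr \<Gamma> x e"
  unfolding nbr_def by blast

lemma nbr_trans: "y \<in> nbr \<Gamma> x e \<Longrightarrow> \<exists>d>0. nbr \<Gamma> y d \<subseteq> nbr \<Gamma> x e"
  unfolding nbr_def by blast

text \<open>The real part of \<open>y\<close> lies in the closure of every side of \<open>y\<close>.
  The bounds are not strict because, for positive \<open>e\<close>, the set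
  \<open>nbr \<Gamma> (Plus a) e\<close> contains \<open>Minus (a + e)\<close> whenever a + e lies
  in \<Gamma>.\<close>

lemma nbr_qmap:
  assumes "y \<in> nbr \<Gamma> x e"
  shows "qmap x - e \<le> qmap y" "qmap y \<le> qmap x + e"
proof -
  obtain d where d: "d > 0" "side y d \<subseteq> side x e"
    using assms by (auto simp: nbr_def)
  have y: "qmap y \<in> closure (side y d)"
    using d(1) by (cases y) auto
  then have "side x e \<noteq> {}"
    using d(2) by auto
  then have "closure (side x e) \<subseteq> {qmap x - e..qmap x + e}"
    by (intro closure_minimal; cases x; auto)
  then have "qmap y \<in> {qmap x - e..qmap x + e}"
    using y closure_mono[OF d(2)] by blast
  then show "qmap x - e \<le> qmap y" "qmap y \<le> qmap x + e"
    by simp_all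
qed

lemma nbr_Plus: "y \<in> nbr \<Gamma> (Plus a) e \<Longrightarrow> a \<in> \<Gamma> \<Longrightarrow> y = Plus a \<or> a < qmap y"
proof -
  assume y: "y \<in> nbr \<Gamma> (Plus a) e" and a: "a \<in> \<Gamma>"
  then obtain d where d: "d > 0" "side y d \<subseteq> {a..<a+e}" "y \<in> RG \<Gamma>"
    by (auto simp: nbr_def)
  from d(3) show ?thesis
  proof (cases rule: RG_cases)
    case (Reg t)
    have "t - d/2 \<in> side y d" using d(1) Reg by simp
    then have "a \<le> t - d/2" using d(2) by auto
    then show ?thesis using d(1) Reg by simp
  next
    case (Plus b)
    have "b \<in> side y d" using d(1) Plus by simp
    with d Plus show ?thesis by auto
  next
    case (Minus b)
    have "b - d/2 \<in> side y d" using d(1) Minus by simp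
    then have "a \<le> b - d/2" using d(2) by auto
    then show ?thesis using d(1) Minus by simp
  qed
qed

lemma nbr_Minus: "y \<in> nbr \<Gamma> (Minus a) e \<Longrightarrow> a \<in> \<Gamma> \<Longrightarrow> y = Minus a \<or> qmap y < a"
proof -
  assume y: "y \<in> nbr \<Gamma> (Minus a) e" and a: "a \<in> \<Gamma>"
  then obtain d where d: "d > 0" "side y d \<subseteq> {a-e<..<a}" "y \<in> RG \<Gamma>"
    by (auto simp: nbr_def)
  from d(3) show ?thesis
  proof (cases rule: RG_cases)
    case (Reg t)
    have "t \<in> side y d" using d(1) Reg by simp
    then have "t < a" using d(2) by auto
    then show ?thesis using Reg by simp
  next
    case (Plus b)
    have "b \<in> side y d" using d(1) Plus by simp
    then have "b < a" using d(2) by auto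
    then show ?thesis using Plus by simp
  next
    case (Minus b)
    have "b \<le> a"
    proof (rule ccontr)
      assume "\<not> b \<le> a"
      then obtain s where "max a (b - d) < s" "s < b"
        using dense[of "max a (b - d)" b] d(1) by auto
      then have "s \<in> side y d" "\<not> s < a" using Minus by auto
      then show False using d(2) by auto
    qed
    then show ?thesis using Minus by auto
  qed
qed

lemma nbr_Reg_I:
  assumes y: "y \<in> RG \<Gamma>" and "\<bar>qmap y - t\<bar> < e"
  shows "y \<in> nbr \<Gamma> (Reg t) e"
proof -
  \<comment> \<open>The radius is the distance from \<open>qmap y\<close> to the nearer end of the
    window.\<close>
  have "side y (min (qmap y - (t - e)) (t + e - qmap y)) \<subseteq> side (Reg t) e"
    by (cases y) auto
  then show ?thesis
    using assms unfolding nbr_def by (auto intro!: exI[of _ "min (qmap y - (t - e)) (t + e - qmap y)"])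
qed

lemma nbr_Plus_I:
  assumes y: "y \<in> RG \<Gamma>" and "0 < e" and "y = Plus a \<or> a < qmap y \<and> qmap y < a + e"
  shows "y \<in> nbr \<Gamma> (Plus a) e"
proof (cases "y = Plus a")
  case True
  then show ?thesis using assms nbr_self by auto
next
  case False
  have "side y (min (qmap y - a) (a + e - qmap y)) \<subseteq> side (Plus a) e"
    by (cases y) auto
  then show ?thesis
    using assms False unfolding nbr_def by (auto intro!: exI[of _ "min (qmap y - a) (a + e - qmap y)"])
qed

lemma nbr_Minus_I:
  assumes y: "y \<in> RG \<Gamma>" and "0 < e" and "y = Minus a \<or> a - e < qmap y \<and> qmap y < a"
  shows "y \<in> nbr \<Gamma> (Minus a) e"
proof (cases "y = Minus a")
  case True
  then show ?thesis using assms nbr_self by auto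
next
  case False
  have "side y (min (qmap y - (a - e)) (a - qmap y)) \<subseteq> side (Minus a) e"
    by (cases y) auto
  then show ?thesis
    using assms False unfolding nbr_def by (auto intro!: exI[of _ "min (qmap y - (a - e)) (a - qmap y)"])
qed

text \<open>The bridge from real points to split points: what holds on a neighbourhood of
  \<open>x\<close> can be tested at the lifts of the reals in its side.\<close>

lemma rlift_in_nbr:
  assumes "x \<in> RG \<Gamma>" "s \<in> side x e"
  shows "rlift \<Gamma> s \<in> nbr \<Gamma> x e"
  using assms(1)
proof (cases rule: RG_cases)
  case (Reg t)
  then show ?thesis using assms nbr_Reg_I[OF rlift_in_RG] by auto
next
  case (Plus a)
  then show ?thesis
    using assms by (cases "s = a") (auto intro!: nbr_Plus_I rlift_in_RG simp: rlift_def[of \<Gamma> a])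
next
  case (Minus a)
  then show ?thesis
    using assms by (auto intro!: nbr_Minus_I rlift_in_RG)
qed

section \<open>The order topology in terms of neighbourhoods\<close>

lemma RG_less_qmap: "RG_less \<Gamma> x y \<Longrightarrow> qmap x \<le> qmap y"
  by (auto simp: RG_less_def)

text \<open>The lift is the largest split point over \<open>u\<close>, so only points with a larger
  real part lie above it.\<close>

lemma rlift_RG_less: "RG_less \<Gamma> (rlift \<Gamma> u) y \<longleftrightarrow> y \<in> RG \<Gamma> \<and> u < qmap y"
  using rlift_in_RG[of \<Gamma> u] by (auto simp: RG_less_def) (auto simp: rlift_def split: if_splits)

lemma RG_lessI: "x \<in> RG \<Gamma> \<Longrightarrow> y \<in> RG \<Gamma> \<Longrightarrow> qmap x < qmap y \<Longrightarrow> RG_less \<Gamma> x y"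
  by (auto simp: RG_less_def)

text \<open>The sets with a neighbourhood around each of their points are closed under finite
  intersections and unions and include the open rays. Conversely, every neighbourhood contains an
  open order interval around its centre.\<close>

lemma openin_RG_top:
  "openin (RG_top \<Gamma>) W \<longleftrightarrow> W \<subseteq> RG \<Gamma> \<and> (\<forall>x\<in>W. \<exists>e>0. nbr \<Gamma> x e \<subseteq> W)" (is "_ \<longleftrightarrow> ?nb W")
proof
  let ?\<S> = "{RG \<Gamma>} \<union> (\<lambda>a. {x \<in> RG \<Gamma>. RG_less \<Gamma> a x}) ` RG \<Gamma> \<union> (\<lambda>a. {x \<in> RG \<Gamma>. RG_less \<Gamma> x a}) ` RG \<Gamma>"
  assume "openin (RG_top \<Gamma>) W"
  then have "generate_topology_on ?\<S> W"
    by (simp add: RG_top_def order_topology_on_def openin_topology_generated_by_iff)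
  then show "?nb W"
  proof induction
    case Empty
    then show ?case by simp
  next
    case (Int U V)
    show ?case
    proof (intro conjI ballI)
      fix x assume "x \<in> U \<inter> V"
      then obtain d e where "d > 0" "e > 0" "nbr \<Gamma> x d \<subseteq> U" "nbr \<Gamma> x e \<subseteq> V"
        using Int by blast
      then show "\<exists>e>0. nbr \<Gamma> x e \<subseteq> U \<inter> V"
        using nbr_mono[of "min d e" d \<Gamma> x] nbr_mono[of "min d e" e \<Gamma> x]
        by (intro exI[of _ "min d e"]) auto
    qed (use Int in auto)
  next
    case (UN K)
    show ?case
    proof (intro conjI ballI)
      fix x assume "x \<in> \<Union>K"
      then obtain k where "k \<in> K" "x \<in> k" by blast
      then obtain e where "e > 0" "nbr \<Gamma> x e \<subseteq> k" using UN by blast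
      then show "\<exists>e>0. nbr \<Gamma> x e \<subseteq> \<Union>K" using \<open>k \<in> K\<close> by blast
    qed (use UN in auto)
  next
    case (Basis S)
    then consider "S = RG \<Gamma>" | z where "z \<in> RG \<Gamma>" "S = {x \<in> RG \<Gamma>. RG_less \<Gamma> z x}"
      | z where "z \<in> RG \<Gamma>" "S = {x \<in> RG \<Gamma>. RG_less \<Gamma> x z}"
      by auto
    then show ?case
    proof cases
      case 1
      then show ?thesis by (auto simp: nbr_def intro: exI[of _ 1])
    next
      case (2 z)
      have "\<exists>e>0. nbr \<Gamma> x e \<subseteq> S" if "x \<in> S" for x
      proof (cases "qmap z < qmap x")
        case True
        have "RG_less \<Gamma> z y" if y: "y \<in> nbr \<Gamma> x ((qmap x - qmap z)/2)" for y
        proof -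
          have "qmap z < qmap y" using nbr_qmap(1)[OF y] True by (simp add: field_simps)
          then show ?thesis using y 2(1) by (simp add: nbr_def RG_less_def)
        qed
        with True show ?thesis
          by (intro exI[of _ "(qmap x - qmap z)/2"]) (auto simp: 2 nbr_def)
      next
        case False
        \<comment> \<open>Over one real number the only strict relation is \<open>Minus a\<close>
          below \<open>Plus a\<close>, and no neighbourhood of \<open>Plus a\<close> reaches
          \<open>Minus a\<close>.\<close>
        then obtain a where a: "a \<in> \<Gamma>" "z = Minus a" "x = Plus a"
          using \<open>x \<in> S\<close> by (auto simp: 2 RG_less_def)
        have "RG_less \<Gamma> z y" if "y \<in> nbr \<Gamma> x 1" for y
          using that nbr_Plus[of y \<Gamma> a 1] a 2(1) by (auto simp: nbr_def RG_less_def)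
        then show ?thesis
          by (intro exI[of _ 1]) (auto simp: 2 nbr_def)
      qed
      then show ?thesis using 2 by auto
    next
      case (3 z)
      have "\<exists>e>0. nbr \<Gamma> x e \<subseteq> S" if "x \<in> S" for x
      proof (cases "qmap x < qmap z")
        case True
        have "RG_less \<Gamma> y z" if y: "y \<in> nbr \<Gamma> x ((qmap z - qmap x)/2)" for y
        proof -
          have "qmap y < qmap z" using nbr_qmap(2)[OF y] True by (simp add: field_simps)
          then show ?thesis using y 3(1) by (simp add: nbr_def RG_less_def)
        qed
        with True show ?thesis
          by (intro exI[of _ "(qmap z - qmap x)/2"]) (auto simp: 3 nbr_def)
      next
        case False
        then obtain a where a: "a \<in> \<Gamma>" "z = Plus a" "x = Minus a"
          using \<open>x \<in> S\<close> by (auto simp: 3 RG_less_def)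
        have "RG_less \<Gamma> y z" if "y \<in> nbr \<Gamma> x 1" for y
          using that nbr_Minus[of y \<Gamma> a 1] a 3(1) by (auto simp: nbr_def RG_less_def)
        then show ?thesis
          by (intro exI[of _ 1]) (auto simp: 3 nbr_def)
      qed
      then show ?thesis using 3 by auto
    qed
  qed
next
  assume nb: "?nb W"
  have ray: "openin (RG_top \<Gamma>) {x \<in> RG \<Gamma>. RG_less \<Gamma> u x \<and> RG_less \<Gamma> x v}"
    if "u \<in> RG \<Gamma>" "v \<in> RG \<Gamma>" for u v
  proof -
    have "openin (RG_top \<Gamma>) {x \<in> RG \<Gamma>. RG_less \<Gamma> u x}" "openin (RG_top \<Gamma>) {x \<in> RG \<Gamma>. RG_less \<Gamma> x v}"
      unfolding RG_top_def order_topology_on_def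
      by (rule topology_generated_by_Basis; use that in blast)+
    moreover have "{x \<in> RG \<Gamma>. RG_less \<Gamma> u x \<and> RG_less \<Gamma> x v}
        = {x \<in> RG \<Gamma>. RG_less \<Gamma> u x} \<inter> {x \<in> RG \<Gamma>. RG_less \<Gamma> x v}"
      by auto
    ultimately show ?thesis by (simp only: openin_Int)
  qed
  show "openin (RG_top \<Gamma>) W"
  proof (rule openin_subopen[THEN iffD2], intro ballI)
    fix x assume "x \<in> W"
    then have x: "x \<in> RG \<Gamma>" and "\<exists>e>0. nbr \<Gamma> x e \<subseteq> W" using nb by blast+
    then obtain e where e: "e > 0" "nbr \<Gamma> x e \<subseteq> W" by blast
    \<comment> \<open>Half the radius leaves room for the upper end, which bounds real parts only
      non-strictly. At a point of \<Gamma> the opposite split point serves as the other end of the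
      interval.\<close>
    have "\<exists>u\<in>RG \<Gamma>. \<exists>v\<in>RG \<Gamma>. RG_less \<Gamma> u x \<and> RG_less \<Gamma> x v \<and>
        {y \<in> RG \<Gamma>. RG_less \<Gamma> u y \<and> RG_less \<Gamma> y v} \<subseteq> nbr \<Gamma> x e"
      using x
    proof (cases rule: RG_cases)
      case (Reg t)
      have "y \<in> nbr \<Gamma> x e"
        if "RG_less \<Gamma> (rlift \<Gamma> (t - e/2)) y" "RG_less \<Gamma> y (rlift \<Gamma> (t + e/2))" for y
      proof -
        have "t - e/2 < qmap y" "qmap y \<le> t + e/2" "y \<in> RG \<Gamma>"
          using that RG_less_qmap[OF that(2)] by (simp_all add: rlift_RG_less)
        then show ?thesis
          unfolding Reg(1) using e(1) by (intro nbr_Reg_I) linarith+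
      qed
      moreover have "RG_less \<Gamma> (rlift \<Gamma> (t - e/2)) x" "RG_less \<Gamma> x (rlift \<Gamma> (t + e/2))"
        using x e(1) Reg(1) by (simp_all add: RG_lessI rlift_in_RG)
      ultimately show ?thesis using rlift_in_RG by blast
    next
      case (Plus a)
      have "y \<in> nbr \<Gamma> x e" if "RG_less \<Gamma> (Minus a) y" "RG_less \<Gamma> y (rlift \<Gamma> (a + e/2))" for y
      proof -
        have "y = Plus a \<or> a < qmap y" "qmap y \<le> a + e/2" "y \<in> RG \<Gamma>"
          using that RG_less_qmap[OF that(2)] by (auto simp: RG_less_def)
        then show ?thesis
          unfolding Plus(1) using e(1) by (intro nbr_Plus_I) auto
      qed
      moreover have "RG_less \<Gamma> (Minus a) x" "RG_less \<Gamma> x (rlift \<Gamma> (a + e/2))" "Minus a \<in> RG \<Gamma>"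
        using x e(1) Plus by (simp_all add: RG_lessI rlift_in_RG) (simp_all add: RG_less_def RG_def)
      ultimately show ?thesis using rlift_in_RG by blast
    next
      case (Minus a)
      have "y \<in> nbr \<Gamma> x e" if "RG_less \<Gamma> (rlift \<Gamma> (a - e/2)) y" "RG_less \<Gamma> y (Plus a)" for y
      proof -
        have "y = Minus a \<or> qmap y < a" "a - e/2 < qmap y" "y \<in> RG \<Gamma>"
          using that by (auto simp: RG_less_def[of _ _ "Plus a"] rlift_RG_less)
        then show ?thesis
          unfolding Minus(1) using e(1) by (intro nbr_Minus_I) auto
      qed
      moreover have "RG_less \<Gamma> (rlift \<Gamma> (a - e/2)) x" "RG_less \<Gamma> x (Plus a)" "Plus a \<in> RG \<Gamma>"
        using x e(1) Minus by (simp_all add: rlift_RG_less) (simp_all add: RG_less_def RG_def)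
      ultimately show ?thesis using rlift_in_RG by blast
    qed
    then obtain u v where uv: "u \<in> RG \<Gamma>" "v \<in> RG \<Gamma>" "RG_less \<Gamma> u x" "RG_less \<Gamma> x v"
      "{y \<in> RG \<Gamma>. RG_less \<Gamma> u y \<and> RG_less \<Gamma> y v} \<subseteq> nbr \<Gamma> x e"
      by blast
    show "\<exists>T. openin (RG_top \<Gamma>) T \<and> x \<in> T \<and> T \<subseteq> W"
    proof (intro exI conjI)
      show "openin (RG_top \<Gamma>) {y \<in> RG \<Gamma>. RG_less \<Gamma> u y \<and> RG_less \<Gamma> y v}"
        by (rule ray[OF uv(1,2)])
    qed (use uv(3-5) e(2) x in auto)
  qed
qed

lemma side_two_points: "0 < e \<Longrightarrow> \<exists>s t. s \<in> side x e \<and> t \<in> side x e \<and> s < t"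
proof (cases x)
  case (Reg t)
  moreover assume "0 < e"
  ultimately show ?thesis by (intro exI[of _ t] exI[of _ "t + e/2"]) auto
next
  case (Plus t)
  moreover assume "0 < e"
  ultimately show ?thesis by (intro exI[of _ t] exI[of _ "t + e/2"]) auto
next
  case (Minus t)
  moreover assume "0 < e"
  ultimately show ?thesis by (intro exI[of _ "t - e/2"] exI[of _ "t - e/4"]) auto
qed

text \<open>The radius of the germ works: a side inside \<open>side x e\<close> inherits the affine
  formula. Hence germs are locally constant.\<close>

lemma has_germ_nbr: "has_germ f x g \<Longrightarrow> \<exists>e>0. \<forall>y\<in>nbr \<Gamma> x e. has_germ f y g"
  unfolding has_germ_def nbr_def by blast

lemma has_germ_rlift: "has_germ f (rlift \<Gamma> t) g \<Longrightarrow> f t = aff g t"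
  by (auto simp: has_germ_def rlift_def split: if_splits)

lemma rlift_in_side: "0 < e \<Longrightarrow> \<exists>u>t. {t..<u} \<subseteq> side (rlift \<Gamma> t) e"
  by (intro exI[of _ "t + e"]) (auto simp: rlift_def)

text \<open>Continuity and openness survive restriction to an open set, so injectivity is the only
  remaining condition. This reduces bisections to open sets on which source and range are
  injective.\<close>

lemma homeomorphic_map_restrict:
  assumes "continuous_map Y Z p" "open_map Y Z p" "openin Y B" "inj_on p B"
  shows "homeomorphic_map (subtopology Y B) (subtopology Z (p ` B)) p"
proof (rule bijective_open_imp_homeomorphic_map)
  have B: "topspace (subtopology Y B) = B"
    using openin_subset[OF assms(3)] by auto
  show "continuous_map (subtopology Y B) (subtopology Z (p ` B)) p"
    using assms(1) by (auto simp: continuous_map_in_subtopology continuous_map_from_subtopology)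
  show "open_map (subtopology Y B) (subtopology Z (p ` B)) p"
    using assms B by (intro open_map_into_subtopology open_map_from_subtopology) auto
  have "p ` B \<subseteq> topspace Z"
    using assms(2,3) by (meson open_map_def openin_subset)
  then show "p ` topspace (subtopology Y B) = topspace (subtopology Z (p ` B))"
    unfolding B by auto
  show "inj_on p (topspace (subtopology Y B))"
    unfolding B by (rule assms(4))
qed

section \<open>Finite partitions of a real interval\<close>

lemma sequence_bounds:
  fixes x :: "nat \<Rightarrow> real"
  assumes "\<forall>i<n. x i < x (Suc i)" "i \<le> n"
  shows "x 0 \<le> x i" "x i \<le> x n"
proof -
  have mono: "x i \<le> x j" if "i \<le> j" "j \<le> n" for i j
    using that
  proof (induction j rule: dec_induct)
    case (step j)
    then show ?case using assms(1) by (metis Suc_le_lessD less_imp_le_nat less_le_not_le linorder_le_less_linear order_trans)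
  qed simp
  show "x 0 \<le> x i" "x i \<le> x n"
    using mono assms(2) by auto
qed

lemma partition_cover_right:
  fixes x :: "nat \<Rightarrow> real"
  shows "x 0 \<le> t \<Longrightarrow> t < x n \<Longrightarrow> \<exists>i<n. x i \<le> t \<and> t < x (Suc i)"
proof (induction n)
  case (Suc n)
  then show ?case by (cases "t < x n") (auto simp: not_less intro: less_SucI)
qed simp

text \<open>Locates the piece that carries the left germ at a point, in particular at a break
  point.\<close>

lemma partition_cover_left:
  fixes x :: "nat \<Rightarrow> real"
  shows "x 0 < t \<Longrightarrow> t \<le> x n \<Longrightarrow> \<exists>i<n. x i < t \<and> t \<le> x (Suc i)"
proof (induction n)
  case (Suc n)
  then show ?case by (cases "t \<le> x n") (auto simp: not_le intro: less_SucI)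
qed simp

text \<open>Listing \<open>S\<close> in increasing order gives the partition: strict sortedness
  leaves no element between two neighbours, and \<open>a\<close> and \<open>b\<close> are its
  extreme elements.\<close>

lemma finite_set_partition:
  fixes S :: "real set"
  assumes "finite S" "S \<subseteq> {a..b}" "a \<in> S" "b \<in> S"
  shows "\<exists>n x. x (0::nat) = a \<and> x n = b \<and> (\<forall>i<n. x i < x (Suc i)) \<and> (\<forall>i\<le>n. x i \<in> S) \<and>
     (\<forall>i<n. {x i<..<x (Suc i)} \<inter> S = {})"
proof -
  define xs where "xs = sorted_list_of_set S"
  have xs: "set xs = S" "sorted_wrt (<) xs"
    using assms(1) by (auto simp: xs_def)
  have mono: "i < j \<Longrightarrow> j < length xs \<Longrightarrow> xs ! i < xs ! j" for i j
    using sorted_wrt_nth_less[OF xs(2)] by blast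
  have "xs \<noteq> []" using xs(1) assms(3) by auto
  define n where "n = length xs - 1"
  have n: "length xs = Suc n" using \<open>xs \<noteq> []\<close> by (simp add: n_def)
  obtain i j where ij: "i < length xs" "xs ! i = a" "j < length xs" "xs ! j = b"
    using assms(3,4) xs(1) by (metis in_set_conv_nth)
  have in_S: "xs ! k \<in> S" if "k \<le> n" for k
    using that n xs(1) by (metis le_imp_less_Suc nth_mem)
  have "i = 0"
    using mono[of 0 i] ij in_S[of 0] assms(2) by (cases "i = 0") force+
  moreover have "j = n"
  proof (rule ccontr)
    assume "j \<noteq> n"
    then have "xs ! j < xs ! n" using mono[of j n] ij n by simp
    then show False using ij in_S[of n] assms(2) by force
  qed
  moreover have "{xs ! k<..<xs ! Suc k} \<inter> S = {}" if "k < n" for k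
  proof -
    have False if y: "y \<in> S" "xs ! k < y" "y < xs ! Suc k" for y
    proof -
      obtain p where p: "p < length xs" "xs ! p = y" using y(1) xs(1) by (metis in_set_conv_nth)
      then show False
        using mono[of p k] mono[of "Suc k" p] y \<open>k < n\<close> n
        by (cases p k rule: linorder_cases) (auto simp: less_Suc_eq_le Suc_le_eq nat_less_le)
    qed
    then show ?thesis by auto
  qed
  ultimately show ?thesis
    using ij in_S mono n by (intro exI[of _ n] exI[of _ "\<lambda>i. xs ! i"]) auto
qed

text \<open>If the half-open images of the pieces cover \<open>[0, l)\<close>, every \<open>b\<close> is approached from the left inside a
  single image: the largest right end below \<open>b\<close> has to be covered by a piece that reaches \<open>b\<close>.\<close>

lemma tiling_left_end:
  fixes x :: "nat \<Rightarrow> real"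
  assumes x: "x 0 = 0" "x n = l"
    and f: "\<forall>i<n. \<forall>t\<in>{x i..<x (Suc i)}. f t = m i * t + d i" "\<forall>i<n. 0 < m i"
    and surj: "{0..<l} \<subseteq> f ` {0..<l}"
    and b: "0 < b" "b \<le> l"
  shows "\<exists>i<n. m i * x i + d i < b \<and> b \<le> m i * x (Suc i) + d i"
proof (rule ccontr)
  assume *: "\<not> ?thesis"
  define E where "E = insert 0 ({m i * x (Suc i) + d i | i. i < n} \<inter> {..<b})"
  have fin: "finite E" by (auto simp: E_def)
  then have "Max E \<in> E" by (intro Max_in) (auto simp: E_def)
  then have "Max E < b" using b(1) by (auto simp: E_def)
  moreover have "0 \<le> Max E" using fin by (intro Max_ge) (auto simp: E_def)
  ultimately have "Max E \<in> f ` {0..<l}" using surj b(2) by auto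
  then obtain t where t: "0 \<le> t" "t < l" "f t = Max E" by auto
  then obtain i where i: "i < n" "x i \<le> t" "t < x (Suc i)"
    using partition_cover_right[of x t n] x by auto
  then have ft: "Max E = m i * t + d i" using f(1) t(3) by auto
  have "m i * x i \<le> m i * t" "m i * t < m i * x (Suc i)" using i f(2) by auto
  then have "m i * x i + d i < b" "Max E < m i * x (Suc i) + d i"
    using ft \<open>Max E < b\<close> by linarith+
  then have "m i * x (Suc i) + d i < b" using * i(1) by (meson not_less)
  then have "m i * x (Suc i) + d i \<in> E" using i(1) by (auto simp: E_def)
  then have "m i * x (Suc i) + d i \<le> Max E" using fin by (rule Max_ge[rotated])
  then show False using \<open>Max E < m i * x (Suc i) + d i\<close> by simp
qed

section \<open>The groupoid\<close>

text \<open>Elementwise closure properties of the data, so that the argument runs on real numbers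
  without the group structures.\<close>

locale affine_data =
  fixes \<Gamma> \<Lambda> :: "real set" and l :: real
  assumes \<Lambda>_pos: "\<mu> \<in> \<Lambda> \<Longrightarrow> 0 < \<mu>"
    and \<Lambda>_one: "1 \<in> \<Lambda>"
    and \<Lambda>_mult: "\<mu> \<in> \<Lambda> \<Longrightarrow> \<nu> \<in> \<Lambda> \<Longrightarrow> \<mu> * \<nu> \<in> \<Lambda>"
    and \<Lambda>_inverse: "\<mu> \<in> \<Lambda> \<Longrightarrow> inverse \<mu> \<in> \<Lambda>"
    and \<Gamma>_zero: "0 \<in> \<Gamma>"
    and \<Gamma>_add: "a \<in> \<Gamma> \<Longrightarrow> b \<in> \<Gamma> \<Longrightarrow> a + b \<in> \<Gamma>"
    and \<Gamma>_uminus: "a \<in> \<Gamma> \<Longrightarrow> - a \<in> \<Gamma>"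
    and \<Gamma>_scale: "\<mu> \<in> \<Lambda> \<Longrightarrow> a \<in> \<Gamma> \<Longrightarrow> \<mu> * a \<in> \<Gamma>"
    and l_in_\<Gamma>: "l \<in> \<Gamma>"
    and l_pos: "0 < l"
begin

abbreviation GL :: "(real \<times> real) set" where
  "GL \<equiv> \<Gamma> \<times> \<Lambda>"

abbreviation gm :: "real \<times> real \<Rightarrow> real \<times> real \<Rightarrow> real \<times> real" (infixl "\<odot>" 70) where
  "g \<odot> h \<equiv> mult (GL_group \<Gamma> \<Lambda>) g h"

abbreviation X :: "split_real set" where
  "X \<equiv> RG_interval \<Gamma> (Plus 0) (Minus l)"

lemma \<Gamma>_diff: "a \<in> \<Gamma> \<Longrightarrow> b \<in> \<Gamma> \<Longrightarrow> a - b \<in> \<Gamma>"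
  using \<Gamma>_add[of a "- b"] \<Gamma>_uminus by simp

section \<open>The affine group and its action on split points\<close>

lemma GL_pos: "g \<in> GL \<Longrightarrow> 0 < snd g"
  by (auto simp: \<Lambda>_pos)

lemma one_in_GL: "(0, 1) \<in> GL"
  by (simp add: \<Gamma>_zero \<Lambda>_one)

lemma gm_in_GL: "g \<in> GL \<Longrightarrow> h \<in> GL \<Longrightarrow> g \<odot> h \<in> GL"
  by (auto simp: GL_group_def \<Lambda>_mult \<Lambda>_inverse \<Gamma>_add \<Gamma>_scale)

lemma ginv_in_GL: "g \<in> GL \<Longrightarrow> ginv g \<in> GL"
  by (auto simp: ginv_def \<Lambda>_inverse \<Gamma>_uminus \<Gamma>_scale)

lemma aff_gm: "h \<in> GL \<Longrightarrow> aff (g \<odot> h) t = aff g (aff h t)"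
  by (cases g; cases h) (auto simp: GL_group_def field_simps dest: \<Lambda>_pos)

lemma aff_ginv: "g \<in> GL \<Longrightarrow> aff (ginv g) (aff g t) = t" "g \<in> GL \<Longrightarrow> aff g (aff (ginv g) t) = t"
  by (cases g; auto simp: ginv_def field_simps dest: \<Lambda>_pos)+

lemma beta_ginv: "g \<in> GL \<Longrightarrow> beta (ginv g) (beta g x) = x" "g \<in> GL \<Longrightarrow> beta g (beta (ginv g) x) = x"
  by (cases g; cases x; auto simp: ginv_def field_simps dest: \<Lambda>_pos)+

lemma aff_in_\<Gamma>: "g \<in> GL \<Longrightarrow> t \<in> \<Gamma> \<Longrightarrow> aff g t \<in> \<Gamma>"
  by (cases g) (simp add: \<Gamma>_add \<Gamma>_scale)

lemma aff_in_\<Gamma>_iff: "g \<in> GL \<Longrightarrow> aff g t \<in> \<Gamma> \<longleftrightarrow> t \<in> \<Gamma>"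
  by (metis aff_in_\<Gamma> aff_ginv(1) ginv_in_GL)

lemma aff_less_iff: "g \<in> GL \<Longrightarrow> aff g s < aff g t \<longleftrightarrow> s < t"
  by (auto dest: \<Lambda>_pos)

lemma beta_rlift: "g \<in> GL \<Longrightarrow> beta g (rlift \<Gamma> t) = rlift \<Gamma> (aff g t)"
  using aff_in_\<Gamma>_iff[of g t] by (cases g) (auto simp: rlift_def)

lemma beta_in_RG: "g \<in> GL \<Longrightarrow> x \<in> RG \<Gamma> \<Longrightarrow> beta g x \<in> RG \<Gamma>"
  using aff_in_\<Gamma>_iff[of g "qmap x"] by (cases g) (auto simp: RG_def)

text \<open>A positive slope preserves orientation, so left sides go to left sides and right sides
  to right sides, with radii scaled by the slope. Equality, not just inclusion, is what allows germs
  to be inverted.\<close>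

lemma side_beta:
  assumes "g \<in> GL"
  shows "side (beta g x) (snd g * e) = aff g ` side x e"
proof -
  have pos: "0 < snd g" using GL_pos[OF assms] .
  have "s \<in> side (beta g x) (snd g * e) \<longleftrightarrow> aff (ginv g) s \<in> side x e" for s
    using pos by (cases g; cases x) (auto simp: ginv_def field_simps)
  then show ?thesis
    using aff_ginv[OF assms] by (auto simp: image_iff) metis
qed

lemma nbr_beta:
  assumes g: "g \<in> GL" and y: "y \<in> nbr \<Gamma> x e"
  shows "beta g y \<in> nbr \<Gamma> (beta g x) (snd g * e)"
proof -
  obtain d where "d > 0" "side y d \<subseteq> side x e" "y \<in> RG \<Gamma>"
    using y by (auto simp: nbr_def)
  then have "side (beta g y) (snd g * d) \<subseteq> side (beta g x) (snd g * e)" "snd g * d > 0"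
    using g GL_pos[OF g] by (auto simp: side_beta)
  then show ?thesis
    using beta_in_RG[OF g \<open>y \<in> RG \<Gamma>\<close>] by (auto simp: nbr_def)
qed

lemma nbr_beta_inverse:
  assumes g: "g \<in> GL" and y: "y \<in> nbr \<Gamma> (beta g x) (snd g * e)"
  shows "beta (ginv g) y \<in> nbr \<Gamma> x e"
proof -
  have "snd (ginv g) * (snd g * e) = e"
    using GL_pos[OF g] by (simp add: ginv_def)
  then show ?thesis
    using nbr_beta[OF ginv_in_GL[OF g] y] by (simp only: beta_ginv[OF g])
qed

section \<open>The compact open interval of split points\<close>

lemma X_iff: "x \<in> X \<longleftrightarrow> x \<in> RG \<Gamma> \<and> 0 \<le> qmap x \<and> qmap x \<le> l \<and> x \<noteq> Minus 0 \<and> x \<noteq> Plus l"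
  using \<Gamma>_zero l_in_\<Gamma> l_pos by (cases x) (auto simp: RG_interval_def RG_le_def RG_less_def RG_def le_less)

lemma X_in_RG: "x \<in> X \<Longrightarrow> x \<in> RG \<Gamma>"
  by (simp add: X_iff)

lemma rlift_in_X: "rlift \<Gamma> t \<in> X \<longleftrightarrow> 0 \<le> t \<and> t < l"
  using rlift_in_RG[of \<Gamma> t] l_in_\<Gamma> by (auto simp: X_iff rlift_def le_less)

lemma Minus_in_X: "Minus a \<in> X \<longleftrightarrow> a \<in> \<Gamma> \<and> 0 < a \<and> a \<le> l"
  by (auto simp: X_iff RG_def)

lemma X_cases:
  assumes "x \<in> X"
  obtains (rlift) t where "x = rlift \<Gamma> t" "0 \<le> t" "t < l" | (Minus) a where "x = Minus a" "a \<in> \<Gamma>" "0 < a" "a \<le> l"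
  using X_in_RG[OF assms]
proof (cases rule: RG_cases)
  case (Reg t)
  then show ?thesis using rlift[of t] assms rlift_in_X[of t] by (simp add: rlift_def)
next
  case (Plus t)
  then show ?thesis using rlift[of t] assms rlift_in_X[of t] by (simp add: rlift_def)
next
  case (Minus a)
  then show ?thesis using that(2)[of a] assms Minus_in_X[of a] by simp
qed

text \<open>The gaps over \<open>0\<close> and \<open>l\<close> make this closed interval open: it
  is cut out by the open rays at \<open>Minus 0\<close> and \<open>Plus l\<close>, the split points
  just outside it.\<close>

lemma openin_X: "openin (RG_top \<Gamma>) X"
proof -
  have "openin (RG_top \<Gamma>) {x \<in> RG \<Gamma>. RG_less \<Gamma> (Minus 0) x}" "openin (RG_top \<Gamma>) {x \<in> RG \<Gamma>. RG_less \<Gamma> x (Plus l)}"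
    unfolding RG_top_def order_topology_on_def
    by (rule topology_generated_by_Basis; use \<Gamma>_zero l_in_\<Gamma> in \<open>auto simp: RG_def\<close>)+
  moreover have "X = {x \<in> RG \<Gamma>. RG_less \<Gamma> (Minus 0) x} \<inter> {x \<in> RG \<Gamma>. RG_less \<Gamma> x (Plus l)}"
    using \<Gamma>_zero l_in_\<Gamma> l_pos by (auto simp: X_iff RG_less_def RG_def le_less)
  ultimately show ?thesis by (simp only: openin_Int)
qed

lemma X_nbr: "x \<in> X \<Longrightarrow> \<exists>e>0. nbr \<Gamma> x e \<subseteq> X"
  using openin_X by (auto simp: openin_RG_top)

text \<open>The lift of every real in the side lies in \<open>X\<close>. The value \<open>l\<close>
  does not occur, since its lift \<open>Plus l\<close> is outside.\<close>

lemma side_in_X: "x \<in> X \<Longrightarrow> nbr \<Gamma> x e \<subseteq> X \<Longrightarrow> side x e \<subseteq> {0..<l}"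
  using rlift_in_nbr X_in_RG rlift_in_X by (meson atLeastLessThan_iff subsetD subsetI)

lemma topspace_RG_top: "topspace (RG_top \<Gamma>) = RG \<Gamma>"
  unfolding topspace_def by (auto simp: openin_RG_top nbr_def intro!: exI[of _ "RG \<Gamma>"] exI[of _ 1])

section \<open>Topology of the arrow space, source and range\<close>

definition arrows :: "((real \<times> real) \<times> split_real) set" where
  "arrows = {(g, x). g \<in> GL \<and> x \<in> X \<and> beta g x \<in> X}"

abbreviation \<G> where "\<G> \<equiv> GL_groupoid \<Gamma> \<Lambda> l"

lemma groupoid_tops:
  "unit_top \<G> = subtopology (RG_top \<Gamma>) X"
  "arrow_top \<G> = subtopology (prod_topology (discrete_topology GL) (RG_top \<Gamma>)) arrows"
  by (auto simp: GL_groupoid_def restricted_transformation_groupoid_def GL_group_def arrows_def)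

lemma groupoid_maps:
  "src \<G> = snd" "rng \<G> = (\<lambda>(g, x). beta g x)" "gunit \<G> = (\<lambda>x. ((0, 1), x))"
  "gmult \<G> = (\<lambda>(g, y) (h, x). (g \<odot> h, x))"
  by (auto simp: GL_groupoid_def restricted_transformation_groupoid_def GL_group_def)

lemma topspace_unit: "topspace (unit_top \<G>) = X"
  using X_in_RG by (auto simp: groupoid_tops topspace_RG_top)

lemma openin_unit: "openin (unit_top \<G>) U \<longleftrightarrow> U \<subseteq> X \<and> openin (RG_top \<Gamma>) U"
  by (auto simp: groupoid_tops openin_open_subtopology[OF openin_X])

lemma arrows_nbr:
  assumes "(g, x) \<in> arrows"
  shows "\<exists>e>0. \<forall>y\<in>nbr \<Gamma> x e. (g, y) \<in> arrows"
proof -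
  from assms have g: "g \<in> GL" "x \<in> X" "beta g x \<in> X" by (auto simp: arrows_def)
  then obtain d e where d: "d > 0" "nbr \<Gamma> x d \<subseteq> X" and e: "e > 0" "nbr \<Gamma> (beta g x) e \<subseteq> X"
    using X_nbr by meson
  \<comment> \<open>The action of \<open>g\<close> multiplies radii by \<open>snd g\<close>, hence
    the quotient.\<close>
  define r where "r = min d (e / snd g)"
  have r: "r > 0" "r \<le> d" "snd g * r \<le> e"
    using d e GL_pos[OF g(1)] by (auto simp: r_def min_def field_simps)
  have "(g, y) \<in> arrows" if "y \<in> nbr \<Gamma> x r" for y
    using that nbr_beta[OF g(1) that] nbr_mono[OF r(2), of \<Gamma> x] nbr_mono[OF r(3), of \<Gamma> "beta g x"] d(2) e(2) g(1)
    by (auto simp: arrows_def)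
  with r(1) show ?thesis by blast
qed

lemma openin_nbr: "openin (RG_top \<Gamma>) (nbr \<Gamma> x e)"
  using nbr_trans by (auto simp: openin_RG_top) (auto simp: nbr_def)

text \<open>The group is discrete, so a basic neighbourhood of an arrow fixes \<open>g\<close> and
  moves only the base point.\<close>

lemma openin_arrow:
  "openin (arrow_top \<G>) W \<longleftrightarrow> W \<subseteq> arrows \<and> (\<forall>(g, x)\<in>W. \<exists>e>0. \<forall>y\<in>nbr \<Gamma> x e. (g, y) \<in> W)"
  (is "_ \<longleftrightarrow> ?nb W")
proof
  assume "openin (arrow_top \<G>) W"
  then obtain T where T: "openin (prod_topology (discrete_topology GL) (RG_top \<Gamma>)) T" "W = T \<inter> arrows"
    by (auto simp: groupoid_tops openin_subtopology)
  have "\<exists>e>0. \<forall>y\<in>nbr \<Gamma> x e. (g, y) \<in> W" if "(g, x) \<in> W" for g x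
  proof -
    have gx: "(g, x) \<in> T" "(g, x) \<in> arrows" using that T(2) by auto
    then obtain U V where "openin (RG_top \<Gamma>) V" "g \<in> U" "x \<in> V" and UV: "U \<times> V \<subseteq> T"
      using openin_prod_topology_alt[THEN iffD1, rule_format, OF T(1) gx(1)] by auto
    then obtain d where "d > 0" "nbr \<Gamma> x d \<subseteq> V"
      by (auto simp: openin_RG_top)
    then have d: "d > 0" "\<forall>y\<in>nbr \<Gamma> x d. (g, y) \<in> T"
      using UV \<open>g \<in> U\<close> by blast+
    obtain e where e: "e > 0" "\<forall>y\<in>nbr \<Gamma> x e. (g, y) \<in> arrows"
      using arrows_nbr[OF gx(2)] by blast
    show ?thesis
      using d e nbr_mono[of "min d e" d \<Gamma> x] nbr_mono[of "min d e" e \<Gamma> x] T(2)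
      by (intro exI[of _ "min d e"]) auto
  qed
  then show "?nb W" using T(2) by auto
next
  assume nb: "?nb W"
  have "openin (prod_topology (discrete_topology GL) (RG_top \<Gamma>)) W"
    unfolding openin_prod_topology_alt
  proof (intro allI impI)
    fix g x assume gx: "(g, x) \<in> W"
    then have "(g, x) \<in> arrows" using nb by blast
    then have gX: "g \<in> GL" "x \<in> RG \<Gamma>" using X_in_RG by (auto simp: arrows_def)
    obtain e where "e > 0" "\<forall>y\<in>nbr \<Gamma> x e. (g, y) \<in> W" using nb gx by blast
    then show "\<exists>U V. openin (discrete_topology GL) U \<and> openin (RG_top \<Gamma>) V \<and> g \<in> U \<and> x \<in> V \<and> U \<times> V \<subseteq> W"
      using gX nbr_self[OF gX(2)] openin_nbr
      by (intro exI[of _ "{g}"] exI[of _ "nbr \<Gamma> x e"]) auto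
  qed
  moreover have "W \<subseteq> arrows" using nb by blast
  ultimately show "openin (arrow_top \<G>) W"
    by (auto simp: groupoid_tops openin_subtopology)
qed

lemma openin_arrowD:
  assumes "openin (arrow_top \<G>) W" "(g, x) \<in> W"
  shows "(g, x) \<in> arrows" "\<exists>e>0. \<forall>y\<in>nbr \<Gamma> x e. (g, y) \<in> W"
  using assms unfolding openin_arrow by blast+

lemma openin_arrowI:
  assumes "W \<subseteq> arrows" "\<And>g x. (g, x) \<in> W \<Longrightarrow> \<exists>e>0. \<forall>y\<in>nbr \<Gamma> x e. (g, y) \<in> W"
  shows "openin (arrow_top \<G>) W"
  using assms unfolding openin_arrow by blast

lemma arrowsD: "(g, x) \<in> arrows \<Longrightarrow> g \<in> GL" "(g, x) \<in> arrows \<Longrightarrow> x \<in> X" "(g, x) \<in> arrows \<Longrightarrow> beta g x \<in> X"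
  by (auto simp: arrows_def)

lemma topspace_arrow: "topspace (arrow_top \<G>) = arrows"
proof
  have "openin (arrow_top \<G>) arrows"
    using arrows_nbr by (intro openin_arrowI) auto
  then show "arrows \<subseteq> topspace (arrow_top \<G>)" by (rule openin_subset)
qed (auto simp: groupoid_tops)

lemma openin_unitI:
  assumes "U \<subseteq> X" "\<And>x. x \<in> U \<Longrightarrow> \<exists>e>0. nbr \<Gamma> x e \<subseteq> U"
  shows "openin (unit_top \<G>) U"
  using assms X_in_RG by (auto simp: openin_unit openin_RG_top)

lemma open_map_src: "open_map (arrow_top \<G>) (unit_top \<G>) (src \<G>)"
  unfolding open_map_def
proof (intro allI impI openin_unitI)
  fix W assume W: "openin (arrow_top \<G>) W"
  show "src \<G> ` W \<subseteq> X"
    using arrowsD(2) openin_arrowD(1)[OF W] by (force simp: groupoid_maps)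
  fix x assume "x \<in> src \<G> ` W"
  then obtain g where "(g, x) \<in> W" by (auto simp: groupoid_maps)
  then obtain e where "e > 0" "\<forall>y\<in>nbr \<Gamma> x e. (g, y) \<in> W"
    using openin_arrowD(2)[OF W] by blast
  then show "\<exists>e>0. nbr \<Gamma> x e \<subseteq> src \<G> ` W"
    by (intro exI[of _ e]) (force simp: groupoid_maps)
qed

text \<open>With \<open>g\<close> fixed, the action is invertible: pulling a point of the scaled
  neighbourhood of the range back by \<open>ginv g\<close> lands in the neighbourhood of the
  source.\<close>

lemma open_map_rng: "open_map (arrow_top \<G>) (unit_top \<G>) (rng \<G>)"
  unfolding open_map_def
proof (intro allI impI openin_unitI)
  fix W assume W: "openin (arrow_top \<G>) W"
  show "rng \<G> ` W \<subseteq> X"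
    using arrowsD(3) openin_arrowD(1)[OF W] by (force simp: groupoid_maps)
  fix z assume "z \<in> rng \<G> ` W"
  then obtain g x where gx: "(g, x) \<in> W" and z: "z = beta g x" by (auto simp: groupoid_maps)
  then obtain e where e: "e > 0" "\<forall>y\<in>nbr \<Gamma> x e. (g, y) \<in> W"
    using openin_arrowD(2)[OF W] by blast
  have g: "g \<in> GL" using openin_arrowD(1)[OF W gx] by (rule arrowsD)
  have "y \<in> rng \<G> ` W" if "y \<in> nbr \<Gamma> z (snd g * e)" for y
  proof -
    have "(g, beta (ginv g) y) \<in> W" using e(2) nbr_beta_inverse[OF g] that z by blast
    then show ?thesis
      by (rule rev_image_eqI) (simp add: groupoid_maps beta_ginv(2)[OF g])
  qed
  then show "\<exists>e>0. nbr \<Gamma> z e \<subseteq> rng \<G> ` W"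
    using e(1) GL_pos[OF g] by (intro exI[of _ "snd g * e"]) auto
qed

lemma continuous_map_src: "continuous_map (arrow_top \<G>) (unit_top \<G>) (src \<G>)"
  unfolding continuous_map_def topspace_arrow topspace_unit
proof (intro conjI allI impI openin_arrowI)
  show "src \<G> \<in> arrows \<rightarrow> X" using arrowsD(2) by (force simp: groupoid_maps)
  fix U g x assume "openin (unit_top \<G>) U" "(g, x) \<in> {x \<in> arrows. src \<G> x \<in> U}"
  then have U: "openin (RG_top \<Gamma>) U" and gx: "(g, x) \<in> arrows" "x \<in> U"
    by (auto simp: openin_unit groupoid_maps)
  obtain d where d: "d > 0" "\<forall>y\<in>nbr \<Gamma> x d. (g, y) \<in> arrows" using arrows_nbr[OF gx(1)] by blast
  obtain e where e: "e > 0" "nbr \<Gamma> x e \<subseteq> U" using U gx(2) unfolding openin_RG_top by blast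
  show "\<exists>e>0. \<forall>y\<in>nbr \<Gamma> x e. (g, y) \<in> {x \<in> arrows. src \<G> x \<in> U}"
    using d e nbr_mono[of "min d e" d \<Gamma> x] nbr_mono[of "min d e" e \<Gamma> x]
    by (intro exI[of _ "min d e"]) (simp add: groupoid_maps subset_iff)
qed auto

lemma continuous_map_rng: "continuous_map (arrow_top \<G>) (unit_top \<G>) (rng \<G>)"
  unfolding continuous_map_def topspace_arrow topspace_unit
proof (intro conjI allI impI openin_arrowI)
  show "rng \<G> \<in> arrows \<rightarrow> X" using arrowsD(3) by (force simp: groupoid_maps)
  fix U g x assume "openin (unit_top \<G>) U" "(g, x) \<in> {x \<in> arrows. rng \<G> x \<in> U}"
  then have U: "openin (RG_top \<Gamma>) U" and gx: "(g, x) \<in> arrows" "beta g x \<in> U"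
    by (auto simp: openin_unit groupoid_maps)
  have g: "g \<in> GL" using gx(1) by (rule arrowsD)
  obtain d where d: "d > 0" "\<forall>y\<in>nbr \<Gamma> x d. (g, y) \<in> arrows" using arrows_nbr[OF gx(1)] by blast
  obtain e where e: "e > 0" "nbr \<Gamma> (beta g x) e \<subseteq> U" using U gx(2) unfolding openin_RG_top by blast
  define r where "r = min d (e / snd g)"
  have r: "r > 0" "r \<le> d" "snd g * r \<le> e"
    using d e GL_pos[OF g] by (auto simp: r_def min_def field_simps)
  have "(g, y) \<in> arrows \<and> beta g y \<in> U" if "y \<in> nbr \<Gamma> x r" for y
    using that nbr_beta[OF g that] nbr_mono[OF r(2), of \<Gamma> x] nbr_mono[OF r(3), of \<Gamma> "beta g x"] d(2) e(2)
    by blast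
  with r(1) show "\<exists>e>0. \<forall>y\<in>nbr \<Gamma> x e. (g, y) \<in> {x \<in> arrows. rng \<G> x \<in> U}"
    by (auto simp: groupoid_maps)
qed auto

section \<open>Bisections, compactness and the carrier of the full group\<close>

lemma bisection_iff:
  "bisection \<G> B \<longleftrightarrow> openin (arrow_top \<G>) B \<and> inj_on (src \<G>) B \<and> inj_on (rng \<G>) B" (is "?L \<longleftrightarrow> ?R")
proof
  assume ?L
  then have B: "openin (arrow_top \<G>) B" and
    p: "p \<in> {src \<G>, rng \<G>} \<Longrightarrow> homeomorphic_map (subtopology (arrow_top \<G>) B) (subtopology (unit_top \<G>) (p ` B)) p" for p
    unfolding bisection_def by blast+
  have "topspace (subtopology (arrow_top \<G>) B) = B"
    using openin_subset[OF B] by auto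
  then show ?R
    using B homeomorphic_imp_injective_map[OF p] by auto
next
  assume ?R
  then show ?L
    unfolding bisection_def
    using homeomorphic_map_restrict[OF continuous_map_src open_map_src]
      homeomorphic_map_restrict[OF continuous_map_rng open_map_rng] open_map_src open_map_rng
    by (auto simp: open_map_def)
qed

text \<open>Bolzano bisection on the real line, applied to the property that the points over [u, v]
  have a finite subcover. Locally one member of the cover suffices off \<Gamma>, and at most two
  suffice at a point of \<Gamma>, one for each split point.\<close>

lemma compactin_X: "compactin (RG_top \<Gamma>) X"
  unfolding compactin_def topspace_RG_top
proof (intro conjI allI impI)
  show "X \<subseteq> RG \<Gamma>" using X_in_RG by blast
  fix \<U> assume \<U>: "Ball \<U> (openin (RG_top \<Gamma>)) \<and> X \<subseteq> \<Union>\<U>"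
  define P where "P u v \<longleftrightarrow> (\<exists>\<F>. finite \<F> \<and> \<F> \<subseteq> \<U> \<and> {x \<in> X. u \<le> qmap x \<and> qmap x \<le> v} \<subseteq> \<Union>\<F>)" for u v
  have nb: "\<exists>U\<in>\<U>. \<exists>e>0. nbr \<Gamma> x e \<subseteq> U" if x: "x \<in> X" for x
  proof -
    obtain U where U: "U \<in> \<U>" "x \<in> U" using \<U> x by blast
    then have "openin (RG_top \<Gamma>) U" using \<U> by blast
    then have "\<exists>e>0. nbr \<Gamma> x e \<subseteq> U" using U(2) by (simp add: openin_RG_top)
    then show ?thesis using U(1) by blast
  qed
  have "P 0 l"
  proof (rule Bolzano)
    fix a b c :: real
    assume "P a b" "P b c" "a \<le> b" "b \<le> c"
    obtain \<F> where F: "finite \<F>" "\<F> \<subseteq> \<U>" "{x \<in> X. a \<le> qmap x \<and> qmap x \<le> b} \<subseteq> \<Union>\<F>"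
      using \<open>P a b\<close> unfolding P_def by blast
    obtain \<F>' where F': "finite \<F>'" "\<F>' \<subseteq> \<U>" "{x \<in> X. b \<le> qmap x \<and> qmap x \<le> c} \<subseteq> \<Union>\<F>'"
      using \<open>P b c\<close> unfolding P_def by blast
    have "{x \<in> X. a \<le> qmap x \<and> qmap x \<le> c}
        \<subseteq> {x \<in> X. a \<le> qmap x \<and> qmap x \<le> b} \<union> {x \<in> X. b \<le> qmap x \<and> qmap x \<le> c}"
      by auto
    then have "{x \<in> X. a \<le> qmap x \<and> qmap x \<le> c} \<subseteq> \<Union>(\<F> \<union> \<F>')"
      using F(3) F'(3) by blast
    then show "P a c" unfolding P_def using F(1,2) F'(1,2) by (intro exI[of _ "\<F> \<union> \<F>'"]) simp
  next
    fix t assume t: "0 \<le> t" "t \<le> l"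
    have "\<exists>e>0. \<exists>\<F>. finite \<F> \<and> \<F> \<subseteq> \<U> \<and> {x \<in> X. t - e < qmap x \<and> qmap x < t + e} \<subseteq> \<Union>\<F>"
    proof (cases "t \<in> \<Gamma>")
      case False
      then have "Reg t \<in> X" using t \<Gamma>_zero l_in_\<Gamma> by (auto simp: X_iff RG_def)
      then obtain U e where "U \<in> \<U>" "e > 0" "nbr \<Gamma> (Reg t) e \<subseteq> U" using nb by blast
      moreover have "{x \<in> X. t - e < qmap x \<and> qmap x < t + e} \<subseteq> nbr \<Gamma> (Reg t) e"
        by (auto intro!: nbr_Reg_I X_in_RG)
      ultimately show ?thesis by (intro exI[of _ e] conjI exI[of _ "{U}"]) simp_all
    next
      case True
      have "\<exists>\<F> e. e > 0 \<and> finite \<F> \<and> \<F> \<subseteq> \<U> \<and> {x \<in> X. x = Plus t \<or> t < qmap x \<and> qmap x < t + e} \<subseteq> \<Union>\<F>"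
      proof (cases "Plus t \<in> X")
        case True
        then obtain U e where "U \<in> \<U>" "e > 0" "nbr \<Gamma> (Plus t) e \<subseteq> U" using nb by blast
        moreover have "{x \<in> X. x = Plus t \<or> t < qmap x \<and> qmap x < t + e} \<subseteq> nbr \<Gamma> (Plus t) e"
          using \<open>e > 0\<close> by (auto intro!: nbr_Plus_I X_in_RG)
        ultimately show ?thesis by (intro exI[of _ e] conjI exI[of _ "{U}"]) simp_all
      next
        case False
        \<comment> \<open>\<open>Plus l\<close> is missing from \<open>X\<close> and nothing in
          \<open>X\<close> lies to its right, so the empty family suffices. The same happens on the
          left of \<open>0\<close>.\<close>
        then have "t = l" using t True by (auto simp: X_iff RG_def)
        with False show ?thesis by (intro exI[of _ 1] exI[of _ "{}"]) (auto simp: X_iff)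
      qed
      moreover have "\<exists>\<F> e. e > 0 \<and> finite \<F> \<and> \<F> \<subseteq> \<U> \<and> {x \<in> X. x = Minus t \<or> t - e < qmap x \<and> qmap x < t} \<subseteq> \<Union>\<F>"
      proof (cases "Minus t \<in> X")
        case True
        then obtain U e where "U \<in> \<U>" "e > 0" "nbr \<Gamma> (Minus t) e \<subseteq> U" using nb by blast
        moreover have "{x \<in> X. x = Minus t \<or> t - e < qmap x \<and> qmap x < t} \<subseteq> nbr \<Gamma> (Minus t) e"
          using \<open>e > 0\<close> by (auto intro!: nbr_Minus_I X_in_RG)
        ultimately show ?thesis by (intro exI[of _ e] conjI exI[of _ "{U}"]) simp_all
      next
        case False
        then have "t = 0" using t True by (auto simp: X_iff RG_def)
        with False show ?thesis by (intro exI[of _ 1] exI[of _ "{}"]) (auto simp: X_iff)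
      qed
      ultimately obtain \<F> d \<F>' e where F: "d > 0" "e > 0" "finite \<F>" "\<F> \<subseteq> \<U>" "finite \<F>'" "\<F>' \<subseteq> \<U>"
       and F7: "{x \<in> X. x = Plus t \<or> t < qmap x \<and> qmap x < t + d} \<subseteq> \<Union>\<F>"
        "{x \<in> X. x = Minus t \<or> t - e < qmap x \<and> qmap x < t} \<subseteq> \<Union>\<F>'"
        by (elim exE conjE) (rule that)
      have "x \<in> \<Union>(\<F> \<union> \<F>')" if x: "x \<in> X" "t - min d e < qmap x" "qmap x < t + min d e" for x
      proof -
        have "x = Plus t \<or> x = Minus t \<or> qmap x < t \<or> t < qmap x"
          using X_in_RG[OF x(1)] True by (cases x) (auto simp: RG_def neq_iff[symmetric])
        then have "x \<in> {x \<in> X. x = Plus t \<or> t < qmap x \<and> qmap x < t + d} \<union>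
            {x \<in> X. x = Minus t \<or> t - e < qmap x \<and> qmap x < t}"
          using x by auto
        then show ?thesis using F7 by blast
      qed
      then have "{x \<in> X. t - min d e < qmap x \<and> qmap x < t + min d e} \<subseteq> \<Union>(\<F> \<union> \<F>')"
        by blast
      then show ?thesis
        using F by (intro exI[of _ "min d e"] conjI exI[of _ "\<F> \<union> \<F>'"]) simp_all
    qed
    then obtain e \<F> where e: "e > 0" and F: "finite \<F>" "\<F> \<subseteq> \<U>" "{x \<in> X. t - e < qmap x \<and> qmap x < t + e} \<subseteq> \<Union>\<F>"
      by blast
    have "P u v" if "u \<le> t \<and> t \<le> v \<and> v - u < e" for u v
    proof -
      have "{x \<in> X. u \<le> qmap x \<and> qmap x \<le> v} \<subseteq> {x \<in> X. t - e < qmap x \<and> qmap x < t + e}"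
        using that by auto
      then show ?thesis
        unfolding P_def using F by blast
    qed
    with e show "\<exists>d>0. \<forall>a b. a \<le> t \<and> t \<le> b \<and> b - a < d \<longrightarrow> P a b" by blast
  qed (use l_pos in simp)
  moreover have "{x \<in> X. 0 \<le> qmap x \<and> qmap x \<le> l} = X" by (auto simp: X_iff)
  ultimately show "\<exists>\<F>. finite \<F> \<and> \<F> \<subseteq> \<U> \<and> X \<subseteq> \<Union>\<F>" unfolding P_def by metis
qed

text \<open>Compactness is automatic: the source map carries such a set homeomorphically onto the
  compact space \<open>X\<close>.\<close>

lemma full_group_carrier:
  "B \<in> carrier (full_group \<G>) \<longleftrightarrow>
     openin (arrow_top \<G>) B \<and> inj_on (src \<G>) B \<and> inj_on (rng \<G>) B \<and> src \<G> ` B = X \<and> rng \<G> ` B = X" (is "?L \<longleftrightarrow> ?R")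
proof -
  have "compactin (arrow_top \<G>) B" if B: "openin (arrow_top \<G>) B" "inj_on (src \<G>) B" "src \<G> ` B = X"
  proof -
    have h: "homeomorphic_map (subtopology (arrow_top \<G>) B) (subtopology (unit_top \<G>) X) (src \<G>)"
      using homeomorphic_map_restrict[OF continuous_map_src open_map_src B(1,2)] B(3) by simp
    have "B \<subseteq> topspace (arrow_top \<G>)" using B(1) by (rule openin_subset)
    then have "compactin (subtopology (arrow_top \<G>) B) B \<longleftrightarrow> compactin (subtopology (unit_top \<G>) X) X"
      using homeomorphic_map_compactness[OF h, of B] B(3) by simp
    moreover have "compactin (subtopology (unit_top \<G>) X) X"
      using compactin_X by (simp add: groupoid_tops compactin_subtopology)
    ultimately show ?thesis by (simp add: compactin_subtopology)
  qed
  then show ?thesis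
    by (auto simp: full_group_def bisection_iff topspace_unit)
qed

section \<open>Maps with affine germs\<close>

text \<open>Every side contains two distinct points. Two common values force equal slopes, and then
  equal translation parts because the slope is not zero.\<close>

lemma has_germ_unique:
  assumes "has_germ f x g" "has_germ f x h" "g \<in> GL" "h \<in> GL"
  shows "g = h"
proof -
  obtain d e where d: "d > 0" "\<forall>s\<in>side x d. f s = aff g s" and e: "e > 0" "\<forall>s\<in>side x e. f s = aff h s"
    using assms(1,2) unfolding has_germ_def by blast
  have sub: "side x (min d e) \<subseteq> side x d" "side x (min d e) \<subseteq> side x e"
    by (simp_all add: side_mono)
  obtain s t where st: "s \<in> side x (min d e)" "t \<in> side x (min d e)" "s < t"
    using side_two_points[of "min d e" x] d(1) e(1) by auto
  have eq: "aff g s = aff h s" "aff g t = aff h t"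
    using d(2) e(2) st sub by (metis subsetD)+
  obtain c \<mu> c' \<mu>' where gh: "g = (c, \<mu>)" "h = (c', \<mu>')" by (cases g; cases h)
  have "\<mu> * (t - s) = \<mu>' * (t - s)" using eq by (simp add: gh algebra_simps)
  then have "\<mu> = \<mu>'" using st(3) by simp
  moreover have "\<mu> > 0" using assms(3) by (auto simp: gh \<Lambda>_pos)
  ultimately show ?thesis using eq(1) by (simp add: gh)
qed

text \<open>The local form of membership in \<open>V_group\<close>, which passes directly to
  composites and inverses. Right continuity and the finite partition are recovered from it
  below.\<close>

definition germ_bij :: "(real \<Rightarrow> real) \<Rightarrow> bool" where
  "germ_bij f \<longleftrightarrow> f \<in> Bij {0..l} \<and> (\<forall>x\<in>X. \<exists>g\<in>GL. has_germ f x g)"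

lemma has_germ_side:
  assumes "x \<in> X" "has_germ f x g"
  shows "\<exists>e>0. side x e \<subseteq> {0..<l} \<and> (\<forall>s\<in>side x e. f s = aff g s)"
proof -
  obtain d where d: "d > 0" "nbr \<Gamma> x d \<subseteq> X" using X_nbr[OF assms(1)] by blast
  obtain e where e: "e > 0" "\<forall>s\<in>side x e. f s = aff g s" using assms(2) unfolding has_germ_def by blast
  have "side x (min d e) \<subseteq> side x d" "side x (min d e) \<subseteq> side x e"
    by (simp_all add: side_mono)
  then show ?thesis
    using d e side_in_X[OF assms(1) d(2)] by (intro exI[of _ "min d e"]) auto
qed

lemma germ_bijD:
  assumes "germ_bij f"
  shows "f \<in> extensional {0..l}" "inj_on f {0..l}" "f ` {0..l} = {0..l}"
    "x \<in> X \<Longrightarrow> \<exists>g\<in>GL. has_germ f x g"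
  using assms by (auto simp: germ_bij_def Bij_def bij_betw_def)

text \<open>If \<open>l\<close> were attained at some s < l, the positive slope of the germ at the
  lift of \<open>s\<close> would push the values just right of \<open>s\<close> above
  \<open>l\<close>.\<close>

lemma germ_bij_fixes_end:
  assumes f: "germ_bij f"
  shows "f l = l"
proof -
  have "l \<in> f ` {0..l}" using germ_bijD(3)[OF f] l_pos by simp
  then obtain s where s: "0 \<le> s" "s \<le> l" "f s = l" by auto
  have "s = l"
  proof (rule ccontr)
    assume "s \<noteq> l"
    then have X: "rlift \<Gamma> s \<in> X" using s by (simp add: rlift_in_X)
    then obtain g where g: "g \<in> GL" "has_germ f (rlift \<Gamma> s) g" using germ_bijD(4)[OF f] by blast
    obtain e where e: "e > 0" "side (rlift \<Gamma> s) e \<subseteq> {0..<l}" "\<forall>s\<in>side (rlift \<Gamma> s) e. f s = aff g s"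
      using has_germ_side[OF X g(2)] by blast
    obtain u where u: "u > s" "{s..<u} \<subseteq> side (rlift \<Gamma> s) e" using rlift_in_side[OF e(1)] by blast
    define t where "t = (s + u) / 2"
    have t: "s < t" "t \<in> side (rlift \<Gamma> s) e" using u by (auto simp: t_def)
    have "l < f t"
      using s(3) has_germ_rlift[OF g(2)] e(3) t aff_less_iff[OF g(1)] by metis
    moreover have "f t \<in> {0..l}" using e(2) t(2) germ_bijD(3)[OF f] by force
    ultimately show False by simp
  qed
  with s show ?thesis by simp
qed

lemma germ_bij_image:
  assumes f: "germ_bij f"
  shows "f ` {0..<l} = {0..<l}"
proof -
  have "{0..<l} = {0..l} - {l}" by auto
  then show ?thesis
    using germ_bijD(2,3)[OF f] germ_bij_fixes_end[OF f] l_pos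
    by (simp add: inj_on_image_set_diff[of f "{0..l}"])
qed

text \<open>At a lift the image is the lift of the value of \<open>f\<close>. At
  \<open>Minus a\<close> the value \<open>f a\<close> may belong to another piece, so the bounds
  come from the values strictly left of \<open>a\<close>: they lie in [0, l), and the limit
  \<open>aff g a\<close> lies in (0, l].\<close>

lemma beta_germ_in_X:
  assumes f: "germ_bij f" and x: "x \<in> X" and g: "g \<in> GL" "has_germ f x g"
  shows "beta g x \<in> X"
  using x
proof (cases rule: X_cases)
  case (rlift t)
  have "f t \<in> {0..<l}" using rlift germ_bij_image[OF f] by force
  then show ?thesis
    using has_germ_rlift g by (simp add: rlift(1) beta_rlift rlift_in_X)
next
  case (Minus a)
  obtain e where e: "e > 0" "side x e \<subseteq> {0..<l}" "\<forall>s\<in>side x e. f s = aff g s"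
    using has_germ_side[OF x g(2)] by blast
  have bnd: "0 \<le> aff g s \<and> aff g s < l" if "a - e < s" "s < a" for s
  proof -
    have "s \<in> side x e" using that Minus(1) by simp
    then have "aff g s \<in> f ` {0..<l}" using e(2,3) by force
    then show ?thesis using germ_bij_image[OF f] by simp
  qed
  have "a - e/2 < a" using e(1) by simp
  then have "0 < aff g a"
    using bnd[of "a - e/2"] e(1) aff_less_iff[OF g(1), of "a - e/2" a] by simp
  moreover have "aff g a \<le> l"
  proof (rule ccontr)
    assume "\<not> aff g a \<le> l"
    \<comment> \<open>The affine map reaches \<open>l\<close> at this point, so it exceeds
      \<open>l\<close> between there and \<open>a\<close>, where it still agrees with
      \<open>f\<close>.\<close>
    then have "aff (ginv g) l < a"
      using aff_less_iff[OF g(1), of "aff (ginv g) l" a] aff_ginv(2)[OF g(1)] by simp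
    then obtain s where s: "max (a - e) (aff (ginv g) l) < s" "s < a"
      using dense[of "max (a - e) (aff (ginv g) l)" a] e(1) by auto
    then have "l < aff g s"
      using aff_less_iff[OF g(1), of "aff (ginv g) l" s] aff_ginv(2)[OF g(1)] by simp
    then show False using bnd[of s] s by simp
  qed
  moreover have "beta g x = Minus (aff g a)" by (cases g) (simp add: Minus(1))
  ultimately show ?thesis
    using aff_in_\<Gamma>[OF g(1) Minus(2)] by (simp add: Minus_in_X)
qed

text \<open>The chain rule for germs: a small side of \<open>x\<close> is mapped by the germ of
  \<open>h\<close> into the side on which the germ of \<open>f\<close> is valid.\<close>

lemma has_germ_compose:
  assumes x: "x \<in> X" and h: "g \<in> GL" "has_germ h x g" and f: "k \<in> GL" "has_germ f (beta g x) k"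
  shows "has_germ (compose {0..l} f h) x (k \<odot> g)"
proof -
  obtain d where d: "d > 0" "side x d \<subseteq> {0..<l}" "\<forall>s\<in>side x d. h s = aff g s"
    using has_germ_side[OF x h(2)] by blast
  obtain e where e: "e > 0" "\<forall>s\<in>side (beta g x) e. f s = aff k s"
    using f(2) unfolding has_germ_def by blast
  define r where "r = min d (e / snd g)"
  have r: "r > 0" "r \<le> d" "snd g * r \<le> e"
    using d e GL_pos[OF h(1)] by (auto simp: r_def min_def field_simps)
  have "compose {0..l} f h s = aff (k \<odot> g) s" if s: "s \<in> side x r" for s
  proof -
    have "s \<in> side x d" using s side_mono[OF r(2)] by blast
    then have "0 \<le> s" "s \<le> l" "h s = aff g s" using d(2,3) by auto
    moreover have "aff g s \<in> side (beta g x) e"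
      using s side_mono[OF r(3), of "beta g x"] by (auto simp: side_beta[OF h(1)])
    ultimately show ?thesis using e(2) by (simp add: compose_def aff_gm[OF h(1)])
  qed
  with r(1) show ?thesis unfolding has_germ_def by blast
qed

text \<open>The affine map sends the side of \<open>x\<close> onto a whole side of
  \<open>beta g x\<close>, so the inverse formula holds throughout that side.\<close>

lemma has_germ_inverse:
  assumes f: "germ_bij f" and x: "x \<in> X" and g: "g \<in> GL" "has_germ f x g"
  shows "has_germ (restrict (inv_into {0..l} f) {0..l}) (beta g x) (ginv g)"
proof -
  obtain e where e: "e > 0" "side x e \<subseteq> {0..<l}" "\<forall>s\<in>side x e. f s = aff g s"
    using has_germ_side[OF x g(2)] by blast
  have "restrict (inv_into {0..l} f) {0..l} s = aff (ginv g) s" if s: "s \<in> side (beta g x) (snd g * e)" for s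
  proof -
    obtain t where t: "t \<in> side x e" "s = aff g t" using s by (auto simp: side_beta[OF g(1)])
    then have "t \<in> {0..l}" "s = f t" using e by auto
    moreover have "f t \<in> {0..l}" using \<open>t \<in> {0..l}\<close> germ_bijD(3)[OF f] by blast
    ultimately show ?thesis
      using t aff_ginv(1)[OF g(1), of t] germ_bijD(2)[OF f] by simp
  qed
  then show ?thesis
    using e(1) GL_pos[OF g(1)] unfolding has_germ_def by (intro exI[of _ "snd g * e"]) simp
qed

section \<open>Piecewise affine maps and germ bijections coincide\<close>

lemma V_group_imp_pieces:
  assumes "f \<in> carrier (V_group \<Gamma> \<Lambda> l)"
  shows "\<exists>n x g. x (0::nat) = 0 \<and> x n = l \<and> (\<forall>i<n. x i < x (Suc i)) \<and> (\<forall>i\<le>n. x i \<in> \<Gamma>) \<and>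
     (\<forall>i<n. g i \<in> GL \<and> (\<forall>t\<in>{x i..<x (Suc i)}. f t = aff (g i) t))"
proof -
  have inj: "inj_on f {0..l}" and im: "f ` {0..l} = {0..l}"
    using assms by (auto simp: V_group_def Bij_def bij_betw_def)
  \<comment> \<open>The definition puts slopes in \<Lambda> and break points in \<Gamma>. That the
    translation parts lie in \<Gamma> has to be derived from bijectivity.\<close>
  from assms have "piecewise_affine \<Gamma> \<Lambda> l f" by (simp add: V_group_def)
  then obtain n x where x: "x (0::nat) = 0" "x n = l" "\<forall>i<n. x i < x (Suc i)" "\<forall>i\<le>n. x i \<in> \<Gamma>"
    "\<forall>i<n. \<exists>\<mu>\<in>\<Lambda>. \<exists>d. \<forall>t\<in>{x i..<x (Suc i)}. f t = \<mu> * t + d"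
    unfolding piecewise_affine_def by blast
  then obtain m d where md: "\<forall>i<n. m i \<in> \<Lambda> \<and> (\<forall>t\<in>{x i..<x (Suc i)}. f t = m i * t + d i)"
    by metis
  have m_pos: "\<forall>i<n. 0 < m i" using md \<Lambda>_pos by blast
  have bounds: "0 \<le> x i" "x i \<le> l" if "i \<le> n" for i
    using sequence_bounds[OF x(3) that] x(1,2) by auto
  have f_x: "f (x i) = m i * x i + d i" if "i < n" for i
    using md x(3) that by auto
  have "l \<in> f ` {0..l}" using im l_pos by simp
  then obtain s where s: "0 \<le> s" "s \<le> l" "f s = l" by auto
  have "s = l"
  proof (rule ccontr)
    assume "s \<noteq> l"
    then obtain i where i: "i < n" "x i \<le> s" "s < x (Suc i)"
      using partition_cover_right[of x s n] x s by auto
    \<comment> \<open>A later point of the same piece, where the positive slope would give a value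
      above \<open>l\<close>.\<close>
    define t where "t = (s + x (Suc i)) / 2"
    have t: "s < t" "t < x (Suc i)" using i(3) by (auto simp: t_def)
    then have "m i * s < m i * t" using m_pos i by simp
    then have "l < f t" using md i t s(3) by auto
    moreover have "t \<in> {0..l}" using t s bounds(2)[of "Suc i"] i(1) by simp
    then have "f t \<in> {0..l}" using im by blast
    ultimately show False by simp
  qed
  then have f_l: "f l = l" using s by simp
  have "{0..<l} = {0..l} - {l}" by auto
  then have im': "f ` {0..<l} = {0..<l}"
    using inj im f_l l_pos by (simp add: inj_on_image_set_diff[of f "{0..l}"])
  \<comment> \<open>The least left end \<open>f (x k)\<close> outside \<open>\<Gamma>\<close> lies in the closure of the image of a piece \<open>j\<close> whose left end
    is in \<open>\<Gamma>\<close>. It is the value of that affine map at a point of \<open>\<Gamma>\<close>, hence itself in \<open>\<Gamma>\<close>.\<close>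
  have f_x_\<Gamma>: "f (x i) \<in> \<Gamma>" if "i < n" for i
  proof (rule ccontr)
    assume "f (x i) \<notin> \<Gamma>"
    define bad where "bad = {f (x j) | j. j < n \<and> f (x j) \<notin> \<Gamma>}"
    have fin: "finite bad" and ne: "bad \<noteq> {}"
      using \<open>i < n\<close> \<open>f (x i) \<notin> \<Gamma>\<close> by (auto simp: bad_def)
    then have "Min bad \<in> bad" by (rule Min_in)
    then obtain k where k: "k < n" "Min bad = f (x k)" "Min bad \<notin> \<Gamma>" by (auto simp: bad_def)
    have "x k < l" using x(3) k(1) bounds(2)[of "Suc k"] by force
    then have "f (x k) \<in> {0..<l}" using im' bounds(1)[of k] k(1) by force
    then have "0 < Min bad" "Min bad \<le> l" using k \<Gamma>_zero by (auto simp: less_le)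
    then obtain j where j: "j < n" "m j * x j + d j < Min bad" "Min bad \<le> m j * x (Suc j) + d j"
      using tiling_left_end[of x n l f m d "Min bad"] x(1,2) md m_pos im' by auto
    have "f (x j) \<notin> bad" using j f_x Min_le[OF fin] by (metis not_less)
    then have "f (x j) \<in> \<Gamma>" using j(1) by (auto simp: bad_def)
    then have dj: "d j \<in> \<Gamma>"
      using f_x[OF j(1)] \<Gamma>_diff[of "f (x j)" "m j * x j"] \<Gamma>_scale md x(4) j(1) by simp
    have mj: "0 < m j" "m j \<in> \<Lambda>" using md m_pos j(1) by auto
    define t where "t = (Min bad - d j) / m j"
    have t: "Min bad = m j * t + d j" using mj by (simp add: t_def)
    have tx: "x j \<le> t" "t \<le> x (Suc j)" using j(2,3) mj(1) by (auto simp: t_def field_simps)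
    \<comment> \<open>Either \<open>t\<close> is the right end of piece \<open>j\<close>, or it lies
      in the half-open piece and injectivity identifies it with \<open>x k\<close>. Both are break
      points.\<close>
    have "t \<in> \<Gamma>"
    proof (cases "t = x (Suc j)")
      case True
      then show ?thesis using x(4) j(1) by auto
    next
      case False
      then have "f t = f (x k)" using md j(1) tx t k(2) by auto
      moreover have "t \<in> {0..l}" using tx bounds[of j] bounds[of "Suc j"] j(1) by simp
      ultimately have "t = x k" using inj bounds[of k] k(1) by (auto dest: inj_onD)
      then show ?thesis using x(4) k(1) by auto
    qed
    then have "Min bad \<in> \<Gamma>" unfolding t using \<Gamma>_add \<Gamma>_scale mj dj by auto
    with k(3) show False by simp
  qed
  have d_\<Gamma>: "d i \<in> \<Gamma>" if "i < n" for i
  proof -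
    have "d i = f (x i) - m i * x i" using f_x[OF that] by simp
    then show ?thesis using \<Gamma>_diff \<Gamma>_scale md x(4) f_x_\<Gamma> that by simp
  qed
  \<comment> \<open>\<open>aff\<close> translates before scaling, so the additive constant is
    divided by the slope.\<close>
  have "(inverse (m i) * d i, m i) \<in> GL \<and>
      (\<forall>t\<in>{x i..<x (Suc i)}. f t = aff (inverse (m i) * d i, m i) t)" if "i < n" for i
  proof
    have "m i \<in> \<Lambda>" "0 < m i" using md m_pos that by auto
    then show "(inverse (m i) * d i, m i) \<in> GL"
      using \<Gamma>_scale[OF \<Lambda>_inverse] d_\<Gamma>[OF that] by simp
    show "\<forall>t\<in>{x i..<x (Suc i)}. f t = aff (inverse (m i) * d i, m i) t"
      using md that \<open>0 < m i\<close> by (auto simp: algebra_simps)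
  qed
  with x show ?thesis by (intro exI[of _ n] exI[of _ x] exI[of _ "\<lambda>i. (inverse (m i) * d i, m i)"]) simp
qed

lemma affine_has_germ_Minus:
  assumes "\<forall>t\<in>{u..<v}. f t = aff g t" "u < a" "a \<le> v"
  shows "has_germ f (Minus a) g"
  unfolding has_germ_def using assms by (intro exI[of _ "a - u"]) auto

lemma V_group_imp_germ_bij:
  assumes "f \<in> carrier (V_group \<Gamma> \<Lambda> l)"
  shows "germ_bij f"
proof -
  obtain n x g where x: "x (0::nat) = 0" "x n = l" "\<forall>i<n. x i < x (Suc i)" "\<forall>i\<le>n. x i \<in> \<Gamma>"
    and g: "\<forall>i<n. g i \<in> GL \<and> (\<forall>t\<in>{x i..<x (Suc i)}. f t = aff (g i) t)"
    using V_group_imp_pieces[OF assms] by blast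
  have "\<exists>g\<in>GL. has_germ f y g" if "y \<in> X" for y
    using that
  proof (cases rule: X_cases)
    case (rlift t)
    then obtain i where i: "i < n" "x i \<le> t" "t < x (Suc i)"
      using partition_cover_right[of x t n] x by auto
    have "has_germ f (rlift \<Gamma> t) (g i)"
    proof (cases "t \<in> \<Gamma>")
      case True
      then show ?thesis
        unfolding has_germ_def using g i by (intro exI[of _ "x (Suc i) - t"]) (auto simp: rlift_def)
    next
      case False
      \<comment> \<open>A point outside \<Gamma> is not a break point, so it has room on both sides
        within its piece.\<close>
      then have "x i < t" using i x(4) by (metis less_imp_le order_le_less)
      have "s \<in> {x i..<x (Suc i)}" if "s \<in> side (rlift \<Gamma> t) (min (t - x i) (x (Suc i) - t))" for s
        using that False by (auto simp: rlift_def min_def split: if_splits)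
      with \<open>x i < t\<close> show ?thesis
        unfolding has_germ_def using g i by (intro exI[of _ "min (t - x i) (x (Suc i) - t)"]) auto
    qed
    then show ?thesis using g i(1) rlift(1) by blast
  next
    case (Minus a)
    then obtain i where "i < n" "x i < a" "a \<le> x (Suc i)"
      using partition_cover_left[of x a n] x by auto
    then show ?thesis using g affine_has_germ_Minus[of "x i" "x (Suc i)" f "g i" a] Minus(1) by blast
  qed
  then show ?thesis using assms by (auto simp: germ_bij_def V_group_def)
qed

lemma germ_bij_right_continuous:
  assumes f: "germ_bij f"
  shows "right_continuous_on {0..l} f"
  unfolding right_continuous_on_def
proof
  fix t assume t: "t \<in> {0..l}"
  show "continuous (at t within {0..l} \<inter> {t..}) f"
  proof (cases "t = l")
    case True
    then have "{0..l} \<inter> {t..} = {t}" using t by auto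
    moreover have "continuous (at t within {t}) f" by (simp add: continuous_within at_within_def)
    ultimately show ?thesis by (simp only:)
  next
    case False
    then have X: "rlift \<Gamma> t \<in> X" using t by (simp add: rlift_in_X)
    then obtain g where g: "g \<in> GL" "has_germ f (rlift \<Gamma> t) g" using germ_bijD(4)[OF f] by blast
    then obtain e where e: "e > 0" "\<forall>s\<in>side (rlift \<Gamma> t) e. f s = aff g s" unfolding has_germ_def by blast
    obtain u where u: "u > t" "{t..<u} \<subseteq> side (rlift \<Gamma> t) e" using rlift_in_side[OF e(1)] by blast
    have aff: "aff g = (\<lambda>s. snd g * (s + fst g))" by (cases g) auto
    have "continuous (at t within {0..l} \<inter> {t..}) (aff g)"
      unfolding aff by (intro continuous_intros)
    then show ?thesis
    proof (rule continuous_transform_within[where \<delta> = "u - t"])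
      show "0 < u - t" "t \<in> {0..l} \<inter> {t..}" using u t by auto
      fix s assume "s \<in> {0..l} \<inter> {t..}" "dist s t < u - t"
      then have "s \<in> {t..<u}" by (auto simp: dist_real_def)
      then show "aff g s = f s" using u(2) e(2) by auto
    qed
  qed
qed

lemma germ_bij_piecewise_affine:
  assumes f: "germ_bij f"
  shows "piecewise_affine \<Gamma> \<Lambda> l f"
proof -
  define L where "L s = (SOME g. g \<in> GL \<and> has_germ f (rlift \<Gamma> s) g)" for s
  have L: "L s \<in> GL \<and> has_germ f (rlift \<Gamma> s) (L s)" if "0 \<le> s" "s < l" for s
  proof -
    have "\<exists>g. g \<in> GL \<and> has_germ f (rlift \<Gamma> s) g"
      using germ_bijD(4)[OF f, of "rlift \<Gamma> s"] that by (auto simp: rlift_in_X)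
    then show ?thesis unfolding L_def by (rule someI_ex)
  qed
  have L_const: "\<exists>e>0. \<exists>g. \<forall>s\<in>side x e. 0 \<le> s \<longrightarrow> s < l \<longrightarrow> L s = g" if x: "x \<in> X" for x
  proof -
    obtain g where g: "g \<in> GL" "has_germ f x g" using germ_bijD(4)[OF f x] by blast
    obtain e where e: "e > 0" "\<forall>y\<in>nbr \<Gamma> x e. has_germ f y g" using has_germ_nbr[OF g(2)] by blast
    have "L s = g" if "s \<in> side x e" "0 \<le> s" "s < l" for s
      using has_germ_unique[of f "rlift \<Gamma> s" "L s" g] L[OF that(2,3)] g(1) e(2)
        rlift_in_nbr[OF X_in_RG[OF x] that(1)] by blast
    with e(1) show ?thesis by blast
  qed
  \<comment> \<open>\<open>L\<close> is locally constant off \<open>\<Gamma>\<close> and jumps at most once near a point of \<open>\<Gamma>\<close>, so bisection yields finitely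
    many jumps, all in \<open>\<Gamma>\<close>.\<close>
  define P where "P u v \<longleftrightarrow> (\<exists>F. finite F \<and> F \<subseteq> \<Gamma> \<and>
    (\<forall>s t. 0 \<le> s \<longrightarrow> t < l \<longrightarrow> u \<le> s \<longrightarrow> s \<le> t \<longrightarrow> t \<le> v \<longrightarrow> {s<..t} \<inter> F = {} \<longrightarrow> L s = L t))" for u v
  have "P 0 l"
  proof (rule Bolzano)
    fix a b c :: real
    assume ab: "P a b" and bc: "P b c" and "a \<le> b" "b \<le> c"
    obtain F where F: "finite F" "F \<subseteq> \<Gamma>"
      "\<And>s t. 0 \<le> s \<Longrightarrow> t < l \<Longrightarrow> a \<le> s \<Longrightarrow> s \<le> t \<Longrightarrow> t \<le> b \<Longrightarrow> {s<..t} \<inter> F = {} \<Longrightarrow> L s = L t"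
      using ab unfolding P_def by blast
    obtain F' where F': "finite F'" "F' \<subseteq> \<Gamma>"
      "\<And>s t. 0 \<le> s \<Longrightarrow> t < l \<Longrightarrow> b \<le> s \<Longrightarrow> s \<le> t \<Longrightarrow> t \<le> c \<Longrightarrow> {s<..t} \<inter> F' = {} \<Longrightarrow> L s = L t"
      using bc unfolding P_def by blast
    have L_eq: "L s = L t" if st: "0 \<le> s" "t < l" "a \<le> s" "s \<le> t" "t \<le> c" "{s<..t} \<inter> (F \<union> F') = {}" for s t
    proof -
      consider "t \<le> b" | "b \<le> s" | "s < b" "b < t" by linarith
      then show ?thesis
      proof cases
        case 1
        then show ?thesis using F(3)[of s t] st by auto
      next
        case 2
        then show ?thesis using F'(3)[of s t] st by auto
      next
        case 3
        have "{s<..b} \<subseteq> {s<..t}" "{b<..t} \<subseteq> {s<..t}" using 3 by auto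
        then have "{s<..b} \<inter> F = {}" "{b<..t} \<inter> F' = {}" using st(6) by blast+
        then have "L s = L b" "L b = L t" using F(3)[of s b] F'(3)[of b t] st 3 by auto
        then show ?thesis by simp
      qed
    qed
    have "finite (F \<union> F')" "F \<union> F' \<subseteq> \<Gamma>" using F(1,2) F'(1,2) by simp_all
    then show "P a c" unfolding P_def using L_eq by blast
  next
    fix r assume r: "0 \<le> r" "r \<le> l"
    show "\<exists>d>0. \<forall>a b. a \<le> r \<and> r \<le> b \<and> b - a < d \<longrightarrow> P a b"
    proof (cases "r \<in> \<Gamma>")
      case False
      then have "Reg r \<in> X" using r \<Gamma>_zero l_in_\<Gamma> by (auto simp: X_iff RG_def)
      then obtain e g where e: "e > 0" "\<forall>s\<in>side (Reg r) e. 0 \<le> s \<longrightarrow> s < l \<longrightarrow> L s = g"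
        using L_const by blast
      have "P a b" if "a \<le> r \<and> r \<le> b \<and> b - a < e" for a b
        unfolding P_def using that e(2) by (intro exI[of _ "{}"]) auto
      with e(1) show ?thesis by blast
    next
      case True
      have "\<exists>e>0. \<exists>g. \<forall>s\<in>{r..<r + e}. 0 \<le> s \<longrightarrow> s < l \<longrightarrow> L s = g"
      proof (cases "r = l")
        case True
        \<comment> \<open>To the right of \<open>l\<close> the condition is vacuous, so any radius
          and label will do; likewise to the left of \<open>0\<close>.\<close>
        then show ?thesis by (intro exI[of _ 1]) auto
      next
        case False
        then have "Plus r \<in> X" using r True by (auto simp: X_iff RG_def)
        from L_const[OF this] show ?thesis by simp
      qed
      then obtain d g where d: "d > 0" "\<forall>s\<in>{r..<r + d}. 0 \<le> s \<longrightarrow> s < l \<longrightarrow> L s = g" by blast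
      have "\<exists>e>0. \<exists>g. \<forall>s\<in>{r - e<..<r}. 0 \<le> s \<longrightarrow> s < l \<longrightarrow> L s = g"
      proof (cases "r = 0")
        case True
        then show ?thesis by (intro exI[of _ 1]) auto
      next
        case False
        then have "Minus r \<in> X" using r True by (auto simp: X_iff RG_def)
        from L_const[OF this] show ?thesis by simp
      qed
      then obtain e h where e: "e > 0" "\<forall>s\<in>{r - e<..<r}. 0 \<le> s \<longrightarrow> s < l \<longrightarrow> L s = h" by blast
      have "P a b" if ab: "a \<le> r \<and> r \<le> b \<and> b - a < min d e" for a b
      proof -
        have L_eq: "L s = L t" if st: "0 \<le> s" "t < l" "a \<le> s" "s \<le> t" "t \<le> b" "{s<..t} \<inter> {r} = {}" for s t
        proof (cases "t < r")
          case True
          then have "L s = h" "L t = h" using e(2) st ab by auto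
          then show ?thesis by simp
        next
          case False
          \<comment> \<open>The half-open interval omits its left end, so s = r is allowed: the
            point \<open>r\<close> carries the label of the piece on its right.\<close>
          then have "r \<le> s" using st(6) by auto
          then have "L s = g" "L t = g" using d(2) st ab by auto
          then show ?thesis by simp
        qed
        have "finite {r}" "{r} \<subseteq> \<Gamma>" using True by simp_all
        then show ?thesis unfolding P_def using L_eq by blast
      qed
      with d(1) e(1) show ?thesis by (intro exI[of _ "min d e"]) auto
    qed
  qed (use l_pos in simp)
  then obtain F where F: "finite F" "F \<subseteq> \<Gamma>"
    "\<And>s t. 0 \<le> s \<Longrightarrow> t < l \<Longrightarrow> s \<le> t \<Longrightarrow> {s<..t} \<inter> F = {} \<Longrightarrow> L s = L t"
    unfolding P_def by (metis less_imp_le)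
  \<comment> \<open>The jumps are clipped to the interval and its ends added, so that the partition
    runs from \<open>0\<close> to \<open>l\<close> with all points in \<Gamma>.\<close>
  define S where "S = F \<inter> {0..l} \<union> {0, l}"
  have S: "finite S" "S \<subseteq> {0..l}" "0 \<in> S" "l \<in> S" "S \<subseteq> \<Gamma>"
    using F(1,2) l_pos \<Gamma>_zero l_in_\<Gamma> by (auto simp: S_def)
  obtain n x where x: "x (0::nat) = 0" "x n = l" "\<forall>i<n. x i < x (Suc i)" "\<forall>i\<le>n. x i \<in> S"
    "\<forall>i<n. {x i<..<x (Suc i)} \<inter> S = {}"
    using finite_set_partition[OF S(1-4)] by blast
  have "\<exists>\<mu>\<in>\<Lambda>. \<exists>d. \<forall>t\<in>{x i..<x (Suc i)}. f t = \<mu> * t + d" if i: "i < n" for i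
  proof -
    have "x i \<in> {0..l}" "x (Suc i) \<in> {0..l}" using S(2) x(4) i by (meson Suc_leI less_imp_le subsetD)+
    then have bnd: "0 \<le> x i" "x (Suc i) \<le> l" by simp_all
    have "f t = snd (L (x i)) * t + snd (L (x i)) * fst (L (x i))" if t: "t \<in> {x i..<x (Suc i)}" for t
    proof -
      have tl: "0 \<le> t" "t < l" using t bnd by auto
      have "{x i<..t} \<inter> F \<subseteq> {x i<..<x (Suc i)} \<inter> S"
        using t tl bnd by (auto simp: S_def)
      then have "{x i<..t} \<inter> F = {}" using x(5) i by blast
      then have "L (x i) = L t" using F(3)[of "x i" t] bnd t tl by auto
      moreover have "f t = aff (L t) t" using L[OF tl] has_germ_rlift by blast
      ultimately show ?thesis by (cases "L t") (simp add: algebra_simps)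
    qed
    moreover have "x i < l" using x(3) bnd i by force
    then have "snd (L (x i)) \<in> \<Lambda>" using L[OF bnd(1)] by auto
    ultimately show ?thesis by blast
  qed
  then show ?thesis
    unfolding piecewise_affine_def using x S(5) by blast
qed

lemma carrier_V_group: "carrier (V_group \<Gamma> \<Lambda> l) = {f. germ_bij f}"
proof -
  have "f \<in> carrier (V_group \<Gamma> \<Lambda> l)" if "germ_bij f" for f
    using that germ_bij_right_continuous[OF that] germ_bij_piecewise_affine[OF that]
    by (simp add: V_group_def germ_bij_def)
  then show ?thesis using V_group_imp_germ_bij by blast
qed

text \<open>A lift is reached through a preimage under \<open>f\<close>. No value of
  \<open>f\<close> represents \<open>Minus b\<close>; the tiling by the images of the pieces
  supplies one that approaches \<open>b\<close> from the left, and the affine map of this piece is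
  inverted at \<open>b\<close>.\<close>

lemma germ_surj:
  assumes f: "germ_bij f" and y: "y \<in> X"
  shows "\<exists>x\<in>X. \<exists>g\<in>GL. has_germ f x g \<and> beta g x = y"
  using y
proof (cases rule: X_cases)
  case (rlift t)
  then obtain s where s: "0 \<le> s" "s < l" "f s = t"
    using germ_bij_image[OF f] by (metis atLeastLessThan_iff imageE)
  then have X: "rlift \<Gamma> s \<in> X" by (simp add: rlift_in_X)
  then obtain g where g: "g \<in> GL" "has_germ f (rlift \<Gamma> s) g" using germ_bijD(4)[OF f] by blast
  then have "beta g (rlift \<Gamma> s) = y"
    using has_germ_rlift[OF g(2)] s(3) by (simp add: beta_rlift rlift(1))
  with X g show ?thesis by blast
next
  case (Minus b)
  obtain n x g where x: "x (0::nat) = 0" "x n = l" "\<forall>i<n. x i < x (Suc i)" "\<forall>i\<le>n. x i \<in> \<Gamma>"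
    and g: "\<forall>i<n. g i \<in> GL \<and> (\<forall>t\<in>{x i..<x (Suc i)}. f t = aff (g i) t)"
    using V_group_imp_pieces[of f] f by (auto simp: carrier_V_group)
  have aff: "aff h = (\<lambda>s. snd h * s + snd h * fst h)" for h
    by (cases h) (auto simp: algebra_simps)
  obtain i where i: "i < n" "aff (g i) (x i) < b" "b \<le> aff (g i) (x (Suc i))"
    using tiling_left_end[of x n l f "\<lambda>i. snd (g i)" "\<lambda>i. snd (g i) * fst (g i)" b]
      x(1,2) g GL_pos germ_bij_image[OF f] Minus(3,4) unfolding aff by auto
  have gi: "g i \<in> GL" using g i(1) by blast
  define a where "a = aff (ginv (g i)) b"
  have b: "b = aff (g i) a" unfolding a_def by (simp only: aff_ginv(2)[OF gi])
  have a: "x i < a" "a \<le> x (Suc i)"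
    using i(2,3) aff_less_iff[OF gi] unfolding b by (simp_all add: not_less[symmetric])
  have "a \<in> \<Gamma>" using aff_in_\<Gamma>_iff[OF gi, of a] Minus(2) b by simp
  moreover have "0 < a" "a \<le> l"
    using a sequence_bounds[OF x(3)] x(1,2) i(1) by (metis order.strict_trans1 less_imp_le, metis Suc_leI order_trans)
  ultimately have "Minus a \<in> X" by (simp add: Minus_in_X)
  moreover have "has_germ f (Minus a) (g i)"
    using affine_has_germ_Minus[of "x i" "x (Suc i)" f "g i" a] g i(1) a by blast
  moreover have "beta (g i) (Minus a) = y"
    unfolding Minus(1) b by (cases "g i") simp
  ultimately show ?thesis using gi by (intro bexI conjI)
qed

section \<open>The group of germ bijections\<close>

lemma germ_bij_id: "germ_bij (\<lambda>t\<in>{0..l}. t)"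
  and has_germ_id: "x \<in> X \<Longrightarrow> has_germ (\<lambda>t\<in>{0..l}. t) x (0, 1)"
proof -
  show germ: "has_germ (\<lambda>t\<in>{0..l}. t) x (0, 1)" if x: "x \<in> X" for x
  proof -
    obtain e where e: "e > 0" "nbr \<Gamma> x e \<subseteq> X" using X_nbr[OF x] by blast
    have "side x e \<subseteq> {0..<l}" using side_in_X[OF x e(2)] .
    then show ?thesis unfolding has_germ_def using e(1) by (intro exI[of _ e]) auto
  qed
  then show "germ_bij (\<lambda>t\<in>{0..l}. t)"
    unfolding germ_bij_def using one_in_GL id_Bij by blast
qed

lemma germ_bij_compose:
  assumes f: "germ_bij f" and h: "germ_bij h"
  shows "germ_bij (compose {0..l} f h)"
proof -
  have "\<exists>g\<in>GL. has_germ (compose {0..l} f h) x g" if x: "x \<in> X" for x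
  proof -
    obtain g where g: "g \<in> GL" "has_germ h x g" using germ_bijD(4)[OF h x] by blast
    obtain k where k: "k \<in> GL" "has_germ f (beta g x) k"
      using germ_bijD(4)[OF f beta_germ_in_X[OF h x g]] by blast
    show ?thesis using has_germ_compose[OF x g k] gm_in_GL[OF k(1) g(1)] by (rule bexI)
  qed
  then show ?thesis using f h compose_Bij by (auto simp: germ_bij_def)
qed

text \<open>By \<open>germ_surj\<close> every point is the image of some \<open>x\<close> under the
  germ there, and inverting that germ gives the germ of the inverse map.\<close>

lemma germ_bij_inverse:
  assumes f: "germ_bij f"
  shows "germ_bij (restrict (inv_into {0..l} f) {0..l})"
proof -
  have "\<exists>g\<in>GL. has_germ (restrict (inv_into {0..l} f) {0..l}) y g" if y: "y \<in> X" for y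
  proof -
    obtain x g where "x \<in> X" "g \<in> GL" "has_germ f x g" "beta g x = y" using germ_surj[OF f y] by blast
    then show ?thesis using has_germ_inverse[OF f] ginv_in_GL by blast
  qed
  moreover have "restrict (inv_into {0..l} f) {0..l} \<in> Bij {0..l}"
    using f by (simp add: germ_bij_def restrict_inv_into_Bij)
  ultimately show ?thesis by (simp add: germ_bij_def)
qed

lemma V_group_eq: "V_group \<Gamma> \<Lambda> l = BijGroup {0..l}\<lparr>carrier := {f. germ_bij f}\<rparr>"
  using carrier_V_group by (simp add: V_group_def)

lemma group_V_group: "group (V_group \<Gamma> \<Lambda> l)"
proof -
  interpret group "BijGroup {0..l}" by (rule group_BijGroup)
  have "subgroup {f. germ_bij f} (BijGroup {0..l})"
  proof (rule subgroupI)
    show "{f. germ_bij f} \<subseteq> carrier (BijGroup {0..l})"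
      by (auto simp: BijGroup_def germ_bij_def)
    show "{f. germ_bij f} \<noteq> {}" using germ_bij_id by blast
    show "inv\<^bsub>BijGroup {0..l}\<^esub> f \<in> {f. germ_bij f}" if "f \<in> {f. germ_bij f}" for f
      using that germ_bij_inverse[of f] by (simp add: germ_bij_def inv_BijGroup)
    show "f \<otimes>\<^bsub>BijGroup {0..l}\<^esub> h \<in> {f. germ_bij f}" if "f \<in> {f. germ_bij f}" "h \<in> {f. germ_bij f}" for f h
      using that germ_bij_compose[of f h] by (simp add: germ_bij_def BijGroup_def)
  qed
  then show ?thesis unfolding V_group_eq by (rule subgroup_imp_group)
qed

section \<open>The isomorphism with the topological full group\<close>

definition germ_set :: "(real \<Rightarrow> real) \<Rightarrow> ((real \<times> real) \<times> split_real) set" where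
  "germ_set f = {(g, x). g \<in> GL \<and> x \<in> X \<and> has_germ f x g}"

lemma ginv_inject: "ginv g = ginv h \<Longrightarrow> g \<in> GL \<Longrightarrow> h \<in> GL \<Longrightarrow> g = h"
  by (cases g; cases h) (auto simp: ginv_def dest: \<Lambda>_pos)

text \<open>Local constancy of germs gives openness, and uniqueness gives injectivity of the source.
  Injectivity of the range is uniqueness for the inverse map, and its surjectivity is
  \<open>germ_surj\<close>.\<close>

lemma germ_set_in_full_group:
  assumes f: "germ_bij f"
  shows "germ_set f \<in> carrier (full_group \<G>)"
  unfolding full_group_carrier
proof (intro conjI)
  show "openin (arrow_top \<G>) (germ_set f)"
  proof (rule openin_arrowI)
    show "germ_set f \<subseteq> arrows"
      using beta_germ_in_X[OF f] by (auto simp: germ_set_def arrows_def)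
    fix g x assume "(g, x) \<in> germ_set f"
    then have gx: "g \<in> GL" "x \<in> X" "has_germ f x g" by (auto simp: germ_set_def)
    obtain d where d: "d > 0" "nbr \<Gamma> x d \<subseteq> X" using X_nbr[OF gx(2)] by blast
    obtain e where e: "e > 0" "\<forall>y\<in>nbr \<Gamma> x e. has_germ f y g" using has_germ_nbr[OF gx(3)] by blast
    have "nbr \<Gamma> x (min d e) \<subseteq> nbr \<Gamma> x d" "nbr \<Gamma> x (min d e) \<subseteq> nbr \<Gamma> x e"
      by (simp_all add: nbr_mono)
    then show "\<exists>e>0. \<forall>y\<in>nbr \<Gamma> x e. (g, y) \<in> germ_set f"
      using d e gx(1) unfolding germ_set_def by (intro exI[of _ "min d e"]) auto
  qed
  show "inj_on (src \<G>) (germ_set f)"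
    unfolding inj_on_def groupoid_maps germ_set_def using has_germ_unique by fastforce
  show "inj_on (rng \<G>) (germ_set f)"
  proof (rule inj_onI)
    fix p q assume pq: "p \<in> germ_set f" "q \<in> germ_set f" "rng \<G> p = rng \<G> q"
    obtain g x h y where *: "p = (g, x)" "q = (h, y)" by (cases p; cases q)
    have gh: "g \<in> GL" "x \<in> X" "has_germ f x g" "h \<in> GL" "y \<in> X" "has_germ f y h" "beta g x = beta h y"
      using pq unfolding * germ_set_def groupoid_maps by auto
    have "ginv g = ginv h"
      using has_germ_unique has_germ_inverse[OF f gh(2,1,3)] has_germ_inverse[OF f gh(5,4,6)]
        ginv_in_GL gh(1,4,7) by metis
    then have "g = h" using ginv_inject gh by blast
    moreover have "x = y" using gh(7) beta_ginv(1)[OF gh(1)] \<open>g = h\<close> by metis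
    ultimately show "p = q" by (simp add: *)
  qed
  show "src \<G> ` germ_set f = X"
    using germ_bijD(4)[OF f] by (force simp: groupoid_maps germ_set_def image_iff)
  show "rng \<G> ` germ_set f = X"
  proof
    show "rng \<G> ` germ_set f \<subseteq> X"
      using beta_germ_in_X[OF f] by (auto simp: groupoid_maps germ_set_def)
    show "X \<subseteq> rng \<G> ` germ_set f"
    proof
      fix y assume "y \<in> X"
      then obtain x g where "x \<in> X" "g \<in> GL" "has_germ f x g" "beta g x = y" using germ_surj[OF f] by blast
      then show "y \<in> rng \<G> ` germ_set f"
        by (intro rev_image_eqI[of "(g, x)"]) (auto simp: groupoid_maps germ_set_def)
    qed
  qed
qed

text \<open>The arrow over the lift of \<open>t\<close> determines the value at \<open>t\<close>,
  and \<open>l\<close> is fixed by every germ bijection.\<close>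

lemma germ_set_inj:
  assumes f: "germ_bij f" and h: "germ_bij h" and eq: "germ_set f = germ_set h"
  shows "f = h"
proof (rule extensionalityI)
  fix t assume t: "t \<in> {0..l}"
  show "f t = h t"
  proof (cases "t = l")
    case True
    then show ?thesis using germ_bij_fixes_end[OF f] germ_bij_fixes_end[OF h] by simp
  next
    case False
    then have X: "rlift \<Gamma> t \<in> X" using t by (simp add: rlift_in_X)
    then obtain g where g: "g \<in> GL" "has_germ f (rlift \<Gamma> t) g" using germ_bijD(4)[OF f] by blast
    then have "(g, rlift \<Gamma> t) \<in> germ_set h" using X eq by (auto simp: germ_set_def)
    then have "has_germ h (rlift \<Gamma> t) g" by (simp add: germ_set_def)
    with g show ?thesis by (simp add: has_germ_rlift)
  qed
qed (use germ_bijD(1) f h in auto)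

lemma germ_set_surj:
  assumes B: "B \<in> carrier (full_group \<G>)"
  shows "\<exists>f. germ_bij f \<and> germ_set f = B"
proof -
  have B_open: "openin (arrow_top \<G>) B" and B_src: "inj_on snd B" "snd ` B = X"
    and B_rng: "inj_on (\<lambda>(g, x). beta g x) B" "(\<lambda>(g, x). beta g x) ` B = X"
    using B unfolding full_group_carrier groupoid_maps by blast+
  have B_arrow: "g \<in> GL" "x \<in> X" "beta g x \<in> X" if "(g, x) \<in> B" for g x
    using arrowsD openin_arrowD(1)[OF B_open that] by blast+
  define lab where "lab x = (THE g. (g, x) \<in> B)" for x
  have lab_eq: "lab x = g" if gx: "(g, x) \<in> B" for g x
    unfolding lab_def
  proof (rule the_equality)
    show "h = g" if "(h, x) \<in> B" for h
      using inj_onD[OF B_src(1) _ that gx] by simp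
  qed (rule gx)
  have lab: "(lab x, x) \<in> B" if x: "x \<in> X" for x
  proof -
    obtain g where "(g, x) \<in> B" using B_src(2) x by force
    then show ?thesis using lab_eq by simp
  qed
  \<comment> \<open>The lift of \<open>l\<close> is outside \<open>X\<close> and has no label; the
    value \<open>l\<close> there is forced by \<open>germ_bij_fixes_end\<close>.\<close>
  define f where "f = (\<lambda>t\<in>{0..l}. if t < l then aff (lab (rlift \<Gamma> t)) t else l)"
  have f_eq: "f t = aff (lab (rlift \<Gamma> t)) t" if "0 \<le> t" "t < l" for t
    using that by (simp add: f_def)
  have f_l: "f l = l" using l_pos by (simp add: f_def)
  have f_beta: "rlift \<Gamma> (f t) = beta (lab (rlift \<Gamma> t)) (rlift \<Gamma> t)" "(lab (rlift \<Gamma> t), rlift \<Gamma> t) \<in> B"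
    if "0 \<le> t" "t < l" for t
  proof -
    show in_B: "(lab (rlift \<Gamma> t), rlift \<Gamma> t) \<in> B" using lab that by (simp add: rlift_in_X)
    show "rlift \<Gamma> (f t) = beta (lab (rlift \<Gamma> t)) (rlift \<Gamma> t)"
      using beta_rlift[OF B_arrow(1)[OF in_B]] f_eq[OF that] by simp
  qed
  have f_range: "0 \<le> f t \<and> f t < l" if "0 \<le> t" "t < l" for t
    using B_arrow(3)[OF f_beta(2)[OF that]] f_beta(1)[OF that] by (metis rlift_in_X)
  have f_inj: "inj_on f {0..<l}"
  proof (rule inj_onI)
    fix s t assume st: "s \<in> {0..<l}" "t \<in> {0..<l}" "f s = f t"
    then have "(lab (rlift \<Gamma> s), rlift \<Gamma> s) = (lab (rlift \<Gamma> t), rlift \<Gamma> t)"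
      using f_beta[of s] f_beta[of t] by (intro inj_onD[OF B_rng(1)]) auto
    then have "qmap (rlift \<Gamma> s) = qmap (rlift \<Gamma> t)" by simp
    then show "s = t" by simp
  qed
  have f_surj: "f ` {0..<l} = {0..<l}"
  proof
    show "f ` {0..<l} \<subseteq> {0..<l}" using f_range by auto
    show "{0..<l} \<subseteq> f ` {0..<l}"
    proof
      fix s assume "s \<in> {0..<l}"
      then have "rlift \<Gamma> s \<in> X" by (simp add: rlift_in_X)
      then obtain g x where gx: "(g, x) \<in> B" "beta g x = rlift \<Gamma> s" using B_rng(2) by force
      from B_arrow(2)[OF gx(1)] show "s \<in> f ` {0..<l}"
      proof (cases rule: X_cases)
        case (rlift t)
        have "rlift \<Gamma> (aff g t) = rlift \<Gamma> s" using gx(2) beta_rlift[OF B_arrow(1)[OF gx(1)]] by (simp add: rlift(1))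
        then have "aff g t = s" by (metis qmap_rlift)
        moreover have "f t = aff g t" using f_eq rlift lab_eq[OF gx(1)] by simp
        ultimately show ?thesis using rlift by force
      next
        case (Minus a)
        \<comment> \<open>The action keeps the kind of a split point, so a \<open>Minus\<close>
          point is never sent to a lift.\<close>
        then show ?thesis using gx(2) by (cases g) (auto simp: rlift_def split: if_splits)
      qed
    qed
  qed
  have I: "{0..l} = insert l {0..<l}" using l_pos by auto
  have "inj_on f {0..l}" "f ` {0..l} = {0..l}"
    unfolding I using f_inj f_surj f_l by auto
  then have f_Bij: "f \<in> Bij {0..l}"
    by (simp add: Bij_def bij_betw_def f_def)
  have germ: "has_germ f x g" if gx: "(g, x) \<in> B" for g x
  proof -
    \<comment> \<open>Openness of \<open>B\<close> keeps the label constant near \<open>x\<close>,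
      so evaluating it at the lifts gives one affine formula on the whole side.\<close>
    obtain e where e: "e > 0" "\<forall>y\<in>nbr \<Gamma> x e. (g, y) \<in> B" using openin_arrowD(2)[OF B_open gx] by blast
    have "f s = aff g s" if "s \<in> side x e" for s
    proof -
      have sB: "(g, rlift \<Gamma> s) \<in> B"
        using e(2) rlift_in_nbr[OF X_in_RG[OF B_arrow(2)[OF gx]] that] by blast
      then have "0 \<le> s" "s < l" using B_arrow(2) rlift_in_X by blast+
      then show ?thesis using f_eq lab_eq[OF sB] by simp
    qed
    with e(1) show ?thesis unfolding has_germ_def by blast
  qed
  have f: "germ_bij f"
    unfolding germ_bij_def using f_Bij lab germ B_arrow(1) by blast
  moreover have "germ_set f = B"
  proof
    show "B \<subseteq> germ_set f" using germ B_arrow by (auto simp: germ_set_def)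
    have "(g, x) \<in> B" if "g \<in> GL" "x \<in> X" "has_germ f x g" for g x
      using has_germ_unique[OF that(3) germ[OF lab[OF that(2)]] that(1) B_arrow(1)[OF lab[OF that(2)]]] lab[OF that(2)]
      by simp
    then show "germ_set f \<subseteq> B" by (auto simp: germ_set_def)
  qed
  ultimately show ?thesis by blast
qed

text \<open>The germ of \<open>h\<close> at \<open>x\<close> ends at \<open>beta g x\<close>, where
  the germ of \<open>f\<close> begins. The chain rule gives one inclusion, and uniqueness of the
  germ of the composite gives the other.\<close>

lemma germ_set_compose:
  assumes f: "germ_bij f" and h: "germ_bij h"
  shows "germ_set (compose {0..l} f h) = germ_set f \<otimes>\<^bsub>full_group \<G>\<^esub> germ_set h" (is "?L = ?R")
proof -
  have R: "p \<in> ?R \<longleftrightarrow> (\<exists>k g x. p = (k \<odot> g, x) \<and> (k, beta g x) \<in> germ_set f \<and> (g, x) \<in> germ_set h)" for p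
    by (force simp: full_group_def groupoid_maps)
  show ?thesis
  proof (intro Set.set_eqI iffI)
    fix p assume "p \<in> ?R"
    then obtain k g x where "p = (k \<odot> g, x)" "k \<in> GL" "has_germ f (beta g x) k" "g \<in> GL" "x \<in> X" "has_germ h x g"
      unfolding R by (auto simp: germ_set_def)
    then show "p \<in> ?L" using has_germ_compose gm_in_GL by (simp add: germ_set_def)
  next
    fix p assume "p \<in> ?L"
    then obtain q x where p: "p = (q, x)" "q \<in> GL" "x \<in> X" "has_germ (compose {0..l} f h) x q"
      by (auto simp: germ_set_def)
    obtain g where g: "g \<in> GL" "has_germ h x g" using germ_bijD(4)[OF h p(3)] by blast
    have X: "beta g x \<in> X" by (rule beta_germ_in_X[OF h p(3) g])
    then obtain k where k: "k \<in> GL" "has_germ f (beta g x) k" using germ_bijD(4)[OF f] by blast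
    have "q = k \<odot> g"
      using has_germ_unique[OF p(4) has_germ_compose[OF p(3) g k] p(2) gm_in_GL[OF k(1) g(1)]] .
    then show "p \<in> ?R" unfolding R using p g k X by (auto simp: germ_set_def)
  qed
qed

lemma germ_set_id: "germ_set (\<lambda>t\<in>{0..l}. t) = \<one>\<^bsub>full_group \<G>\<^esub>"
proof -
  have "g = (0, 1)" if "g \<in> GL" "x \<in> X" "has_germ (\<lambda>t\<in>{0..l}. t) x g" for g x
    using has_germ_unique[OF that(3) has_germ_id[OF that(2)] that(1) one_in_GL] .
  then have "germ_set (\<lambda>t\<in>{0..l}. t) = (\<lambda>x. ((0, 1), x)) ` X"
    using has_germ_id one_in_GL by (auto simp: germ_set_def)
  moreover have "\<one>\<^bsub>full_group \<G>\<^esub> = (\<lambda>x. ((0, 1), x)) ` X"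
    by (simp add: full_group_def topspace_unit groupoid_maps(3))
  ultimately show ?thesis by simp
qed

lemma germ_set_iso: "germ_set \<in> iso (V_group \<Gamma> \<Lambda> l) (full_group \<G>)"
proof (rule isoI)
  show "germ_set \<in> hom (V_group \<Gamma> \<Lambda> l) (full_group \<G>)"
  proof (rule homI)
    show "germ_set f \<in> carrier (full_group \<G>)" if "f \<in> carrier (V_group \<Gamma> \<Lambda> l)" for f
      using that germ_set_in_full_group by (simp add: carrier_V_group)
    fix f h assume "f \<in> carrier (V_group \<Gamma> \<Lambda> l)" "h \<in> carrier (V_group \<Gamma> \<Lambda> l)"
    then have fh: "germ_bij f" "germ_bij h" by (simp_all add: carrier_V_group)
    then have "f \<otimes>\<^bsub>V_group \<Gamma> \<Lambda> l\<^esub> h = compose {0..l} f h"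
      by (simp add: V_group_eq BijGroup_def germ_bij_def)
    then show "germ_set (f \<otimes>\<^bsub>V_group \<Gamma> \<Lambda> l\<^esub> h) = germ_set f \<otimes>\<^bsub>full_group \<G>\<^esub> germ_set h"
      by (simp only: germ_set_compose[OF fh])
  qed
  show "bij_betw germ_set (carrier (V_group \<Gamma> \<Lambda> l)) (carrier (full_group \<G>))"
    unfolding bij_betw_def carrier_V_group
    using germ_set_in_full_group germ_set_inj germ_set_surj by (auto simp: inj_on_def image_iff) metis
qed

text \<open>The group laws are transported along \<open>germ_set\<close> instead of being checked on
  bisections; \<open>germ_set_id\<close> identifies the transported unit with the set of
  units.\<close>

lemma group_full_group: "group (full_group \<G>)"
proof -
  interpret V: group "V_group \<Gamma> \<Lambda> l" by (rule group_V_group)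
  have "germ_set ` carrier (V_group \<Gamma> \<Lambda> l) = carrier (full_group \<G>)"
    using germ_set_iso by (simp add: iso_def bij_betw_def)
  moreover have "germ_set \<one>\<^bsub>V_group \<Gamma> \<Lambda> l\<^esub> = \<one>\<^bsub>full_group \<G>\<^esub>"
    using germ_set_id by (simp add: V_group_eq BijGroup_def)
  moreover have "germ_set \<in> hom (V_group \<Gamma> \<Lambda> l) (full_group \<G>)"
    using germ_set_iso by (simp add: iso_def)
  ultimately show ?thesis
    using V.hom_imp_img_group[of germ_set "full_group \<G>"] by simp
qed

end

section \<open>From the algebraic hypotheses to the isomorphism\<close>

theorem lemma4p4:
  fixes \<Lambda> \<Gamma> :: "real set" and l :: real
  assumes "subgroup \<Lambda> pos_real_group"
    and "countable \<Lambda>"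
    and "ZLambda_submodule \<Lambda> \<Gamma>"
    and "l \<in> \<Gamma>"
    and "l > 1"
  shows "group (full_group (GL_groupoid \<Gamma> \<Lambda> l)) \<and> group (V_group \<Gamma> \<Lambda> l) \<and>
         full_group (GL_groupoid \<Gamma> \<Lambda> l) \<cong> V_group \<Gamma> \<Lambda> l"
proof -
  have pos: "group pos_real_group"
    by (rule groupI) (auto simp: pos_real_group_def intro!: exI[of _ "inverse _"] bexI[of _ "inverse _"])
  have add: "group real_add_group"
    by (rule groupI) (auto simp: real_add_group_def intro: exI[of _ "- _"])
  \<comment> \<open>Closure of a subgroup refers to abstract inverses; computing them as real
    reciprocals and negatives yields the closure properties of \<open>affine_data\<close>.\<close>
  have inv_pos: "inv\<^bsub>pos_real_group\<^esub> \<mu> = inverse \<mu>" if "0 < \<mu>" for \<mu>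
    using that by (intro group.inv_equality[OF pos]) (auto simp: pos_real_group_def)
  have inv_add: "inv\<^bsub>real_add_group\<^esub> a = - a" for a
    by (intro group.inv_equality[OF add]) (auto simp: real_add_group_def)
  have sub: "subgroup \<Gamma> real_add_group" and scale: "{\<mu> * a |\<mu> a. \<mu> \<in> \<Lambda> \<and> a \<in> \<Gamma>} = \<Gamma>"
    using assms(3) by (auto simp: ZLambda_submodule_def)
  have \<Lambda>_pos: "0 < \<mu>" if "\<mu> \<in> \<Lambda>" for \<mu>
    using subgroup.mem_carrier[OF assms(1) that] by (simp add: pos_real_group_def)
  interpret affine_data \<Gamma> \<Lambda> l
  proof
    show "1 \<in> \<Lambda>" using subgroup.one_closed[OF assms(1)] by (simp add: pos_real_group_def)
    show "\<mu> * \<nu> \<in> \<Lambda>" if "\<mu> \<in> \<Lambda>" "\<nu> \<in> \<Lambda>" for \<mu> \<nu>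
      using subgroup.m_closed[OF assms(1) that] by (simp add: pos_real_group_def)
    show "inverse \<mu> \<in> \<Lambda>" if "\<mu> \<in> \<Lambda>" for \<mu>
      using subgroup.m_inv_closed[OF assms(1) that] inv_pos[OF \<Lambda>_pos[OF that]] by simp
    show "0 \<in> \<Gamma>" using subgroup.one_closed[OF sub] by (simp add: real_add_group_def)
    show "a + b \<in> \<Gamma>" if "a \<in> \<Gamma>" "b \<in> \<Gamma>" for a b
      using subgroup.m_closed[OF sub that] by (simp add: real_add_group_def)
    show "- a \<in> \<Gamma>" if "a \<in> \<Gamma>" for a
      using subgroup.m_inv_closed[OF sub that] by (simp add: inv_add)
    show "\<mu> * a \<in> \<Gamma>" if "\<mu> \<in> \<Lambda>" "a \<in> \<Gamma>" for \<mu> a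
      using scale that by blast
  qed (use \<Lambda>_pos assms(4,5) in auto)
  have "V_group \<Gamma> \<Lambda> l \<cong> full_group (GL_groupoid \<Gamma> \<Lambda> l)"
    using germ_set_iso by (auto simp: is_iso_def)
  then show ?thesis
    using group_V_group group_full_group group.iso_sym by blast
qed

end
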